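(* Let $c=1/(12\pi^2 e)$, let $n\ge4$ and $r$ be integers, and let $u=n/r$. If $n^{1/3}(\log n)^{2/3}\le r\le c\,n(\log n)^{-1}(\log\log n)^{-2}$, then $$\nu(n,r)=\varrho(u)\exp\left\{\frac{u\,\xi(u)}{2r}\right\}\left(1+O\left(\frac{u\log^2(u+1)}{r^2}+\frac1u\right)\right).$$
   Context: $S_n$ is the symmetric group on $n$ symbols and $k_j(\sigma)$ is the number of cycles of length $j$ in $\sigma\in S_n$. For $1\le r\le n$, $$\nu(n,r)=\frac1{n!}\left|\{\sigma\in S_n:\ k_j(\sigma)=0 \text{ for all } r+1\le j\le n\}\right|.$$ $\varrho$ is the Dickman function: the continuous function on $[0,\infty)$ with $\varrho(v)=1$ for $v\in[0,1]$ and $v\varrho'(v)+\varrho(v-1)=0$ for $v>1$. For $v>1$, $\xi(v)$ is the positive solution to $e^{\xi(v)}=1+v\xi(v)$, and $\xi(1)=0$. The implied constant in $O(\cdot)$ is absolute (uniform over all $n,r$ in the stated range). $\log$ is the natural logarithm. *)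

theory Defs
  imports
    "HOL-Analysis.Analysis"
    "HOL-Combinatorics.Permutations"
    "HOL-Combinatorics.Orbits"
begin

section \<open>Permutations without long cycles\<close>

text \<open>
  The cycles of a permutation are its orbits; a fixed point \<open>x\<close> is the
  cycle \<open>{x}\<close> of length 1.
\<close>

definition cycle_count :: "nat \<Rightarrow> (nat \<Rightarrow> nat) \<Rightarrow> nat \<Rightarrow> nat" where
  "cycle_count n \<sigma> j = card {C \<in> orbit \<sigma> ` {1..n}. card C = j}"

definition nu :: "nat \<Rightarrow> nat \<Rightarrow> real" where
  "nu n r = real (card {\<sigma>. \<sigma> permutes {1..n} \<and> (\<forall>j\<in>{r+1..n}. cycle_count n \<sigma> j = 0)}) / fact n"


section \<open>The Dickman function\<close>

text \<open>
  The function lives on \<open>[0, \<infinity>)\<close>; it is extended by 0 to the negative reals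
  only to make it unique as a function on all reals.
\<close>

definition is_dickman :: "(real \<Rightarrow> real) \<Rightarrow> bool" where
  "is_dickman f \<longleftrightarrow>
     continuous_on {0..} f \<and>
     (\<forall>v\<in>{0..1}. f v = 1) \<and>
     (\<forall>v>1. f differentiable (at v) \<and> v * deriv f v + f (v - 1) = 0) \<and>
     (\<forall>v<0. f v = 0)"

definition dickman :: "real \<Rightarrow> real" where
  "dickman = (THE f. is_dickman f)"

lemma is_dickman_DERIV:
  assumes "is_dickman f" "v > 1"
  shows "(f has_real_derivative - f (v - 1) / v) (at v)"
proof -
  have d: "f differentiable (at v)" and e: "v * deriv f v + f (v - 1) = 0"
    using assms by (auto simp: is_dickman_def)
  have "deriv f v = - f (v - 1) / v"
    using e assms(2) by (simp add: field_simps)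
  moreover have "(f has_real_derivative deriv f v) (at v)"
    using d by (simp add: DERIV_deriv_iff_real_differentiable)
  ultimately show ?thesis by simp
qed

lemma is_dickman_unique:
  assumes f: "is_dickman f" and g: "is_dickman g"
  shows "f = g"
proof -
  have "\<forall>v\<in>{0..real (Suc k)}. f v = g v" for k
  proof (induction k)
    case 0
    show ?case using f g by (simp add: is_dickman_def)
  next
    case (Suc k)
    show ?case
    proof
      fix v assume v: "v \<in> {0..real (Suc (Suc k))}"
      show "f v = g v"
      proof (cases "v \<le> 1")
        case True
        then show ?thesis using f g v by (simp add: is_dickman_def)
      next
        case False
        define h where "h = (\<lambda>x. f x - g x)"
        have "continuous_on {0..} h"
          using f g unfolding h_def is_dickman_def by (intro continuous_on_diff) auto
        then have c: "continuous_on {1..v} h"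
          by (rule continuous_on_subset) auto
        have d: "(h has_real_derivative 0) (at x)" if x: "1 < x" "x < v" for x
        proof -
          have "x - 1 \<in> {0..real (Suc k)}" using x v by auto
          then have e: "f (x - 1) = g (x - 1)" using Suc.IH by blast
          have "(h has_real_derivative (- f (x - 1) / x - (- g (x - 1) / x))) (at x)"
            unfolding h_def
            by (intro DERIV_diff is_dickman_DERIV f g x)
          then show ?thesis using e by simp
        qed
        have "h v = h 1"
          using DERIV_isconst_end[of 1 v h] c d False by auto
        moreover have "h 1 = 0"
          using f g by (simp add: h_def is_dickman_def)
        ultimately show ?thesis by (simp add: h_def)
      qed
    qed
  qed
  note * = this
  show ?thesis
  proof
    fix v
    show "f v = g v"
    proof (cases "v < 0")
      case True
      then show ?thesis using f g by (simp add: is_dickman_def)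
    next
      case False
      obtain k :: nat where "v \<le> real k" using real_arch_simple by blast
      then show ?thesis using False *[of k] by auto
    qed
  qed
qed

primrec dickman_approx :: "nat \<Rightarrow> real \<Rightarrow> real" where
  "dickman_approx 0 v = 1"
| "dickman_approx (Suc k) v = 1 - integral {1..v} (\<lambda>t. dickman_approx k (t - 1) / t)"

lemma dickman_approx_le_1: "v \<le> 1 \<Longrightarrow> dickman_approx k v = 1"
proof (cases k)
  case (Suc m)
  assume "v \<le> 1"
  then have "v = 1 \<or> {1..v} = {}" by auto
  then show ?thesis using Suc by auto
qed simp

lemma dickman_approx_DERIV:
  assumes c: "continuous_on UNIV (dickman_approx k)" and v: "v > 1"
  shows "(dickman_approx (Suc k) has_real_derivative - dickman_approx k (v - 1) / v) (at v)"
proof -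
  let ?F = "dickman_approx k"
  have "continuous_on {1..v + 1} (\<lambda>t. ?F (t - 1) / t)"
    by (intro continuous_intros continuous_on_compose2[OF c]) auto
  then have "((\<lambda>x. integral {1..x} (\<lambda>t. ?F (t - 1) / t))
      has_real_derivative ?F (v - 1) / v) (at v within {1..v + 1})"
    using v by (intro integral_has_real_derivative) auto
  then have "((\<lambda>x. integral {1..x} (\<lambda>t. ?F (t - 1) / t))
      has_real_derivative ?F (v - 1) / v) (at v)"
    using v by (subst (asm) at_within_interior) auto
  from DERIV_diff[OF DERIV_const[of 1] this]
  have "((\<lambda>x. 1 - integral {1..x} (\<lambda>t. ?F (t - 1) / t)) has_real_derivative - ?F (v - 1) / v) (at v)"
    by simp
  moreover have "dickman_approx (Suc k) = (\<lambda>x. 1 - integral {1..x} (\<lambda>t. ?F (t - 1) / t))"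
    by (rule ext) (rule dickman_approx.simps(2))
  ultimately show ?thesis by simp
qed

lemma dickman_approx_continuous: "continuous_on UNIV (dickman_approx k)"
proof (induction k)
  case 0
  show ?case by simp
next
  case (Suc k)
  let ?F = "dickman_approx (Suc k)"
  let ?I = "\<lambda>x. integral {1..x} (\<lambda>t. dickman_approx k (t - 1) / t)"
  have "continuous_on {1..b} ?F" for b
  proof -
    have "continuous_on {1..b} (\<lambda>t. dickman_approx k (t - 1) / t)"
      by (intro continuous_intros continuous_on_compose2[OF Suc.IH]) auto
    then have "continuous_on {1..b} ?I"
      by (intro indefinite_integral_continuous_1 integrable_continuous_real)
    then have "continuous_on {1..b} (\<lambda>x. 1 - ?I x)"
      by (intro continuous_intros)
    then show ?thesis by simp
  qed
  note c1 = this
  show ?case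
  proof -
    have "continuous_on {..b} ?F" for b
    proof -
      have "continuous_on ({..1} \<union> {1..b}) (\<lambda>x. if x \<le> 1 then 1 else ?F x)"
        using c1[of b] by (intro continuous_on_cases) (auto simp: dickman_approx_le_1 simp del: dickman_approx.simps)
      moreover have "(\<lambda>x. if x \<le> 1 then 1 else ?F x) = ?F"
        by (auto simp: fun_eq_iff dickman_approx_le_1 simp del: dickman_approx.simps)
      ultimately have "continuous_on ({..1} \<union> {1..b}) ?F" by metis
      then show ?thesis by (rule continuous_on_subset) auto
    qed
    then have "isCont ?F x" for x
      using continuous_on_interior[of "{..x + 1}" ?F x] by simp
    then show ?thesis by (simp add: continuous_at_imp_continuous_on del: dickman_approx.simps)
  qed
qed

lemma dickman_approx_Suc:
  "v \<le> real (Suc k) \<Longrightarrow> dickman_approx (Suc k) v = dickman_approx k v"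
proof (induction k arbitrary: v)
  case 0
  then show ?case by (simp add: dickman_approx_le_1 del: dickman_approx.simps)
next
  case (Suc k)
  have "integral {1..v} (\<lambda>t. dickman_approx (Suc k) (t - 1) / t) =
        integral {1..v} (\<lambda>t. dickman_approx k (t - 1) / t)"
  proof (rule integral_cong)
    fix t assume "t \<in> {1..v}"
    then have "t - 1 \<le> real (Suc k)" using Suc.prems by auto
    from Suc.IH[OF this]
    show "dickman_approx (Suc k) (t - 1) / t = dickman_approx k (t - 1) / t" by simp
  qed
  then show ?case
    by (metis dickman_approx.simps(2))
qed

lemma dickman_approx_stable:
  assumes "k \<le> m" "v \<le> real (Suc k)"
  shows "dickman_approx m v = dickman_approx k v"
  using assms(1)
proof (induction m rule: dec_induct)
  case (step m)
  have "v \<le> real (Suc m)" using step assms(2) by simp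
  from dickman_approx_Suc[OF this] show ?case using step by simp
qed simp

lemma ex_is_dickman: "\<exists>f. is_dickman f"
proof -
  define R where "R = (\<lambda>v. dickman_approx (nat \<lceil>v\<rceil>) v)"
  define f where "f = (\<lambda>v. if v < 0 then 0 else R v)"
  have R: "R v = dickman_approx k v" if "v \<le> real k" for k v
    unfolding R_def using that
    by (intro dickman_approx_stable[THEN sym]) linarith+
  have ev: "\<exists>k. (\<forall>\<^sub>F x in nhds v. R x = dickman_approx k x) \<and> v < real k" for v
  proof -
    obtain k :: nat where k: "v < real k" using reals_Archimedean2 by blast
    have "\<forall>\<^sub>F x in nhds v. x \<in> {..<real k}"
      using k by (intro eventually_nhds_in_open) auto
    then have "\<forall>\<^sub>F x in nhds v. R x = dickman_approx k x"
      by eventually_elim (auto intro: R)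
    with k show ?thesis by blast
  qed
  have "isCont R v" for v
  proof -
    obtain k where "\<forall>\<^sub>F x in nhds v. R x = dickman_approx k x" using ev by blast
    then show ?thesis
      using dickman_approx_continuous[of k] by (simp add: isCont_cong continuous_on_eq_continuous_at)
  qed
  then have "continuous_on {0..} R" by (simp add: continuous_at_imp_continuous_on)
  then have 1: "continuous_on {0..} f"
    by (rule continuous_on_eq) (auto simp: f_def)
  have 2: "f v = 1" if "v \<in> {0..1}" for v
    using that by (simp add: f_def R_def dickman_approx_le_1)
  have 3: "(f has_real_derivative - f (v - 1) / v) (at v)" if v: "v > 1" for v
  proof -
    obtain k where k: "\<forall>\<^sub>F x in nhds v. R x = dickman_approx k x" "v < real k"
      using ev by blast
    have k': "\<forall>\<^sub>F x in nhds v. R x = dickman_approx (Suc k) x"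
    proof -
      have "\<forall>\<^sub>F x in nhds v. x \<in> {..<real k}"
        using k by (intro eventually_nhds_in_open) auto
      then show ?thesis
        by eventually_elim (rule R, simp)
    qed
    have "\<forall>\<^sub>F x in nhds v. x \<in> {0<..}"
      using v by (intro eventually_nhds_in_open) auto
    with k' have e: "\<forall>\<^sub>F x in nhds v. f x = dickman_approx (Suc k) x"
      by eventually_elim (auto simp: f_def)
    have "f (v - 1) = dickman_approx k (v - 1)"
      using v k by (simp add: f_def R)
    moreover have "(dickman_approx (Suc k) has_real_derivative - dickman_approx k (v - 1) / v) (at v)"
      using dickman_approx_DERIV dickman_approx_continuous v by blast
    ultimately show ?thesis
      using DERIV_cong_ev[OF refl e refl] by (simp del: dickman_approx.simps)
  qed
  have 4: "f differentiable (at v) \<and> v * deriv f v + f (v - 1) = 0" if v: "v > 1" for v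
    using 3[OF v] DERIV_imp_deriv[OF 3[OF v]] v real_differentiable_def by auto
  have "is_dickman f"
    unfolding is_dickman_def using 1 2 4 by (auto simp: f_def)
  then show ?thesis by blast
qed

lemma is_dickman_dickman: "is_dickman dickman"
  unfolding dickman_def
  using ex_is_dickman is_dickman_unique by (metis theI)


section \<open>The saddle point function\<close>

definition xi :: "real \<Rightarrow> real" where
  "xi v = (if v = 1 then 0 else (THE x. x > 0 \<and> exp x = 1 + v * x))"

lemma ex1_xi:
  assumes v: "v > (1::real)"
  shows "\<exists>!x. x > 0 \<and> exp x = 1 + v * x"
proof -
  define h where "h = (\<lambda>x::real. exp x - 1 - v * x)"
  have d: "(h has_real_derivative (exp x - v)) (at x)" for x
    unfolding h_def by (auto intro!: derivative_eq_intros)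
  have c: "continuous_on A h" for A
    unfolding h_def by (intro continuous_intros)
  have h0: "h 0 = 0" by (simp add: h_def)
  have lv: "ln v > 0" using v by simp
  have dec: "h x < 0" if "0 < x" "x \<le> ln v" for x
  proof -
    have "h x < h 0"
    proof (rule DERIV_neg_imp_decreasing_open[OF that(1)])
      fix y assume y: "0 < y" "y < x"
      then have "exp y < exp (ln v)" using that by simp
      then show "\<exists>z. (h has_real_derivative z) (at y) \<and> z < 0"
        using d[of y] v by (intro exI[of _ "exp y - v"]) auto
    qed (rule c)
    then show ?thesis using h0 by simp
  qed
  have inc: "h x < h y" if "ln v \<le> x" "x < y" for x y
  proof (rule DERIV_pos_imp_increasing_open[OF that(2)])
    fix z assume z: "x < z" "z < y"
    then have "exp (ln v) < exp z" using that by simp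
    then show "\<exists>w. (h has_real_derivative w) (at z) \<and> w > 0"
      using d[of z] v by (intro exI[of _ "exp z - v"]) auto
  qed (rule c)
  have big: "h (2 * v) > 0"
  proof -
    have "1 + 2 * v + (2 * v)\<^sup>2 / 2 \<le> exp (2 * v)"
      using exp_lower_Taylor_quadratic[of "2 * v"] v by simp
    then show ?thesis using v by (simp add: h_def power2_eq_square)
  qed
  have l2: "ln v \<le> 2 * v" using ln_less_self[of v] v by linarith
  obtain x where x: "ln v \<le> x" "x \<le> 2 * v" "h x = 0"
    using IVT'[of h "ln v" 0 "2 * v"] dec[of "ln v"] lv big l2 c by force
  have u: "y = x" if "y > 0" "h y = 0" for y
  proof -
    have "ln v < y" using dec[of y] that by force
    then show ?thesis
      using inc[of x y] inc[of y x] x that by (cases x y rule: linorder_cases) auto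
  qed
  show ?thesis
  proof (rule ex1I[of _ x])
    show "x > 0 \<and> exp x = 1 + v * x" using x lv by (auto simp: h_def)
    show "y = x" if "y > 0 \<and> exp y = 1 + v * y" for y
      using that u[of y] by (auto simp: h_def)
  qed
qed

lemma xi_props: "v > 1 \<Longrightarrow> xi v > 0 \<and> exp (xi v) = 1 + v * xi v"
  using theI'[OF ex1_xi] by (auto simp: xi_def)

end

theory Submission
  imports Defs "HOL-Combinatorics.Cycles"
begin

text \<open>
Both \<open>\<nu>\<close> and the Dickman function \<open>\<rho>\<close> are determined by an averaging rule: splitting off the cycle
through one point gives \<open>n \<nu>(n, r) = \<nu>(n - 1, r) + \<dots> + \<nu>(n - r, r)\<close>, and the delay equation
integrates to \<open>v \<rho>(v) = \<integral>\<^bsub>v-1\<^esub>\<^bsup>v\<^esup> \<rho>\<close>. The proof compares these two rules directly and needs no contour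
integrals.

Put \<open>F(m) = \<rho>((m + 1/2) / (r + 1/2))\<close>. Then \<open>F(m) = 1 = \<nu>(m, r)\<close> for \<open>m \<le> r\<close>, and the midpoint rule
applied to \<open>\<integral>\<^bsub>v-1\<^esub>\<^bsup>v\<^esup> \<rho>\<close> shows that \<open>F\<close> satisfies the recurrence of \<open>\<nu>\<close> up to a relative error
\<open>O(log\<^sup>2 (u + 1) / r\<^sup>2)\<close> (lemma \<open>dickman_at_recurrence_relative\<close>). Each step averages over a window of
length \<open>r\<close>, so these errors accumulate once per window (lemma \<open>window_recurrence_comparison\<close>). After
\<open>u = n / r\<close> windows, \<open>\<nu>(n, r) = F(n) exp (O(u log\<^sup>2 (u + 1) / r\<^sup>2))\<close>.

It remains to compare \<open>F(n)\<close> with \<open>\<rho>(u)\<close>. The argument of \<open>\<rho>\<close> in \<open>F(n)\<close> lies below \<open>u\<close> by nearly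
\<open>u / (2 r)\<close>, and such a shift multiplies \<open>\<rho>\<close> by the exponential of \<open>u / (2 r)\<close> times the decay rate
\<open>- \<rho>' / \<rho>\<close>. The rate is increasing, i.e. \<open>\<rho>\<close> is log-concave (lemma \<open>dickman_rate_mono\<close>), and inserting
this into the averaging rule pins it between \<open>\<xi>(v)\<close> and \<open>\<xi>(v + 1)\<close> (lemmas \<open>xi_le_dickman_rate\<close> and
\<open>dickman_rate_le_xi\<close>). As \<open>\<xi>\<close> varies slowly, the factor is \<open>exp (u \<xi>(u) / (2 r))\<close> with an error in the
exponent of order \<open>u log (u + 1) / r\<^sup>2 + log (u + 1) / r\<close>, and the last term is the geometric mean of
the two error terms \<open>u log\<^sup>2 (u + 1) / r\<^sup>2\<close> and \<open>1 / u\<close> of the theorem.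
\<close>

section \<open>The recurrence for permutations without long cycles\<close>

definition short_cycle_perms :: "nat \<Rightarrow> 'a set \<Rightarrow> ('a \<Rightarrow> 'a) set" where
  "short_cycle_perms r S = {\<sigma>. \<sigma> permutes S \<and> (\<forall>x\<in>S. card (orbit \<sigma> x) \<le> r)}"

lemma finite_short_cycle_perms: "finite S \<Longrightarrow> finite (short_cycle_perms r S)"
  unfolding short_cycle_perms_def by (rule finite_subset[OF _ finite_permutations]) auto

lemma set_support_eq_orbit:
  assumes "permutation p"
  shows "set (support p x) = orbit p x"
  unfolding support_set[OF assms] orbit_altdef_permutation[OF assms] by auto

lemma support_eq_Cons:
  assumes "permutation p"
  shows "support p x = x # tl (support p x)"
  using least_power_of_permutation(2)[OF assms, of x] by (simp add: upt_conv_Cons)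

text \<open>
Composes a permutation of \<open>S - set (x # ys)\<close> with the cycle that runs through \<open>x\<close> and then
the list \<open>ys\<close>, so that \<open>x # ys\<close> becomes the orbit of \<open>x\<close>.
\<close>

definition splice_cycle :: "'a \<Rightarrow> 'a list \<times> ('a \<Rightarrow> 'a) \<Rightarrow> 'a \<Rightarrow> 'a" where
  "splice_cycle x = (\<lambda>(ys, \<tau>). cycle_of_list (x # ys) \<circ> \<tau>)"

lemma splice_cycle_on_cycle:
  assumes "\<tau> permutes S - set (x # ys)" "y \<in> set (x # ys)"
  shows "splice_cycle x (ys, \<tau>) y = cycle_of_list (x # ys) y"
  using assms by (auto simp: splice_cycle_def permutes_def)

lemma splice_cycle_off_cycle:
  assumes "\<tau> permutes S - set (x # ys)" "y \<notin> set (x # ys)"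
  shows "splice_cycle x (ys, \<tau>) y = \<tau> y"
proof -
  have "\<tau> y \<notin> set (x # ys)"
  proof (cases "y \<in> S")
    case True
    then have "\<tau> y \<in> S - set (x # ys)"
      using assms permutes_in_image[of \<tau> "S - set (x # ys)" y] by blast
    then show ?thesis by auto
  next
    case False
    then have "\<tau> y = y" using assms by (auto simp: permutes_def)
    then show ?thesis using assms by simp
  qed
  then show ?thesis by (simp add: splice_cycle_def id_outside_supp del: cycle_of_list.simps)
qed

lemma splice_cycle_permutes:
  assumes "\<tau> permutes S - set (x # ys)" "set (x # ys) \<subseteq> S"
  shows "splice_cycle x (ys, \<tau>) permutes S"
proof -
  have "cycle_of_list (x # ys) permutes S"
    using permutes_subset[OF cycle_permutes assms(2)] .
  moreover have "\<tau> permutes S" using permutes_subset[OF assms(1)] by auto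
  ultimately show ?thesis unfolding splice_cycle_def by (auto intro: permutes_compose)
qed

lemma splice_cycle_funpow:
  assumes "\<tau> permutes S - set (x # ys)" "distinct (x # ys)"
  shows "(splice_cycle x (ys, \<tau>) ^^ i) x = (x # ys) ! (i mod length (x # ys))"
proof -
  let ?c = "cycle_of_list (x # ys)"
  have c: "(?c ^^ i) x = (x # ys) ! (i mod length (x # ys))" for i
  proof -
    have "(?c ^^ i) x = map (?c ^^ i) (x # ys) ! 0" by simp
    also have "\<dots> = (x # ys) ! (i mod length (x # ys))"
      unfolding cyclic_rotation[OF assms(2)] by (subst nth_rotate) auto
    finally show ?thesis .
  qed
  have "(splice_cycle x (ys, \<tau>) ^^ i) x = (?c ^^ i) x"
  proof (induction i)
    case (Suc i)
    have "(?c ^^ i) x \<in> set (x # ys)" unfolding c by (rule nth_mem) simp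
    then show ?case using Suc splice_cycle_on_cycle[OF assms(1)] by simp
  qed simp
  then show ?thesis using c by simp
qed

lemma splice_cycle_support:
  assumes "\<tau> permutes S - set (x # ys)" "distinct (x # ys)"
  shows "support (splice_cycle x (ys, \<tau>)) x = x # ys"
proof -
  let ?p = "splice_cycle x (ys, \<tau>)" and ?n = "length (x # ys)"
  have n: "(?p ^^ ?n) x = x" unfolding splice_cycle_funpow[OF assms] by simp
  then have le: "least_power ?p x \<le> ?n" by (intro least_power_le) auto
  have lp: "(?p ^^ least_power ?p x) x = x" "least_power ?p x > 0"
    using least_powerI[OF n] by auto
  have "least_power ?p x = ?n"
  proof (rule ccontr)
    assume "least_power ?p x \<noteq> ?n"
    then have lt: "least_power ?p x < ?n" using le by simp
    then have "(x # ys) ! least_power ?p x = (x # ys) ! 0"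
      using lp splice_cycle_funpow[OF assms, of "least_power ?p x"] by simp
    then have "least_power ?p x = 0" using nth_eq_iff_index_eq[OF assms(2) lt, of 0] by simp
    then show False using lp by simp
  qed
  then have "support ?p x = map (\<lambda>i. (x # ys) ! i) [0..<?n]"
    unfolding splice_cycle_funpow[OF assms] by (intro map_cong) auto
  then show ?thesis by (simp only: map_nth)
qed

text \<open>
A permutation of \<open>S\<close> is determined by the cycle through a chosen element \<open>x\<close>, read off as a list
starting at \<open>x\<close>, and its restriction to the rest of \<open>S\<close>. All other orbits are untouched by the
splicing, which is why the bound on the cycle lengths carries over in both directions.
\<close>

lemma bij_betw_splice_cycle:
  assumes S: "finite S" "x \<in> S"
  shows "bij_betw (splice_cycle x)
    (SIGMA ys:{ys. length ys < r \<and> distinct ys \<and> set ys \<subseteq> S - {x}}. short_cycle_perms r (S - set (x # ys)))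
    (short_cycle_perms r S)"
proof (rule bij_betw_byWitness[where f' = "\<lambda>p. (tl (support p x), perm_restrict p (S - orbit p x))"])
  let ?A = "SIGMA ys:{ys. length ys < r \<and> distinct ys \<and> set ys \<subseteq> S - {x}}. short_cycle_perms r (S - set (x # ys))"
  let ?g = "\<lambda>p. (tl (support p x), perm_restrict p (S - orbit p x))"
  have perm: "permutation p" if "p permutes S" for p
    using that S by (auto simp: permutation_permutes)
  show "\<forall>a\<in>?A. ?g (splice_cycle x a) = a"
  proof clarify
    fix ys \<tau> assume ys: "length ys < r" "distinct ys" "set ys \<subseteq> S - {x}"
      and t: "\<tau> \<in> short_cycle_perms r (S - set (x # ys))"
    let ?p = "splice_cycle x (ys, \<tau>)"
    have t': "\<tau> permutes S - set (x # ys)" and d: "distinct (x # ys)" and sub: "set (x # ys) \<subseteq> S"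
      using t ys S by (auto simp: short_cycle_perms_def)
    have supp: "support ?p x = x # ys" by (rule splice_cycle_support[OF t' d])
    have orb: "orbit ?p x = set (x # ys)"
      using set_support_eq_orbit[OF perm[OF splice_cycle_permutes[OF t' sub]], of x] supp by simp
    have "perm_restrict ?p (S - set (x # ys)) = \<tau>"
    proof
      fix y
      show "perm_restrict ?p (S - set (x # ys)) y = \<tau> y"
      proof (cases "y \<in> S - set (x # ys)")
        case True
        then show ?thesis using splice_cycle_off_cycle[OF t', of y] by (simp add: perm_restrict_def)
      next
        case False
        then show ?thesis using permutes_not_in[OF t', of y] perm_restrict_simps(2)[OF False, of ?p] by simp
      qed
    qed
    then show "tl (support ?p x) = ys \<and> perm_restrict ?p (S - orbit ?p x) = \<tau>"
      using supp orb by simp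
  qed
  show "\<forall>p\<in>short_cycle_perms r S. splice_cycle x (?g p) = p"
  proof
    fix p assume "p \<in> short_cycle_perms r S"
    then have p: "p permutes S" by (simp add: short_cycle_perms_def)
    define ys where "ys = tl (support p x)"
    have supp: "support p x = x # ys" unfolding ys_def by (rule support_eq_Cons[OF perm[OF p]])
    have orb: "orbit p x = set (x # ys)" using set_support_eq_orbit[OF perm[OF p], of x] supp by simp
    have t: "perm_restrict p (S - set (x # ys)) permutes S - set (x # ys)"
      using perm_restrict_diff_cyclic[OF p cyclic_on_orbit[OF p S(1), of x]] orb by simp
    have "splice_cycle x (ys, perm_restrict p (S - set (x # ys))) y = p y" for y
    proof (cases "y \<in> set (x # ys)")
      case True
      then show ?thesis using splice_cycle_on_cycle[OF t] cycle_restrict[OF perm[OF p], of y x] supp by metis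
    next
      case False
      then show ?thesis
        using splice_cycle_off_cycle[OF t, of y] permutes_not_in[OF p, of y]
        by (cases "y \<in> S") (simp_all add: perm_restrict_def)
    qed
    then show "splice_cycle x (?g p) = p" using orb by (auto simp: ys_def)
  qed
  show "splice_cycle x ` ?A \<subseteq> short_cycle_perms r S"
  proof clarify
    fix ys \<tau> assume ys: "length ys < r" "distinct ys" "set ys \<subseteq> S - {x}"
      and t: "\<tau> \<in> short_cycle_perms r (S - set (x # ys))"
    let ?p = "splice_cycle x (ys, \<tau>)"
    have t': "\<tau> permutes S - set (x # ys)" and d: "distinct (x # ys)" and sub: "set (x # ys) \<subseteq> S"
      using t ys S by (auto simp: short_cycle_perms_def)
    have p: "?p permutes S" by (rule splice_cycle_permutes[OF t' sub])
    have orb: "orbit ?p x = set (x # ys)"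
      using set_support_eq_orbit[OF perm[OF p], of x] splice_cycle_support[OF t' d] by simp
    have "card (orbit ?p y) \<le> r" if y: "y \<in> S" for y
    proof (cases "y \<in> set (x # ys)")
      case True
      then have "orbit ?p y = set (x # ys)"
        using orb orbit_cyclic_eq3[OF cyclic_on_orbit[OF p S(1)]] by metis
      then show ?thesis using distinct_card[OF d] ys by simp
    next
      case False
      have "orbit \<tau> y = orbit ?p y"
      proof (rule orbit_cong0[where A = "S - set (x # ys)"])
        show "\<tau> \<in> (S - set (x # ys)) \<rightarrow> S - set (x # ys)" using permutes_in_image[OF t'] by blast
        show "\<tau> z = ?p z" if "z \<in> S - set (x # ys)" for z
          using splice_cycle_off_cycle[OF t', of z] that by simp
      qed (use False y in auto)
      moreover have "card (orbit \<tau> y) \<le> r" using t y False unfolding short_cycle_perms_def by blast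
      ultimately show ?thesis by simp
    qed
    then show "?p \<in> short_cycle_perms r S" using p by (simp add: short_cycle_perms_def)
  qed
  show "?g ` short_cycle_perms r S \<subseteq> ?A"
  proof clarify
    fix p assume pg: "p \<in> short_cycle_perms r S"
    then have p: "p permutes S" by (simp add: short_cycle_perms_def)
    define ys where "ys = tl (support p x)"
    have supp: "support p x = x # ys" unfolding ys_def by (rule support_eq_Cons[OF perm[OF p]])
    have orb: "orbit p x = set (x # ys)" using set_support_eq_orbit[OF perm[OF p], of x] supp by simp
    have d: "distinct (x # ys)" using cycle_of_permutation[OF perm[OF p], of x] supp by simp
    have sub: "set (x # ys) \<subseteq> S" using permutes_orbit_subset[OF p S(2)] orb by simp
    have t: "perm_restrict p (S - set (x # ys)) permutes S - set (x # ys)"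
      using perm_restrict_diff_cyclic[OF p cyclic_on_orbit[OF p S(1), of x]] orb by simp
    have "card (set (x # ys)) \<le> r" using pg S orb by (auto simp: short_cycle_perms_def)
    then have len: "length ys < r" using distinct_card[OF d] by simp
    have "card (orbit (perm_restrict p (S - set (x # ys))) y) \<le> r" if y: "y \<in> S - set (x # ys)" for y
    proof -
      have "orbit (perm_restrict p (S - set (x # ys))) y = orbit p y"
      proof (rule orbit_cong0[OF y])
        show "perm_restrict p (S - set (x # ys)) \<in> (S - set (x # ys)) \<rightarrow> S - set (x # ys)"
          using t permutes_in_image by fastforce
      qed (simp add: perm_restrict_def)
      then show ?thesis using pg y by (auto simp: short_cycle_perms_def)
    qed
    then have "perm_restrict p (S - set (x # ys)) \<in> short_cycle_perms r (S - set (x # ys))"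
      using t by (simp add: short_cycle_perms_def)
    then show "tl (support p x) \<in> {ys. length ys < r \<and> distinct ys \<and> set ys \<subseteq> S - {x}} \<and>
       perm_restrict p (S - orbit p x) \<in> short_cycle_perms r (S - set (x # tl (support p x)))"
      using len d sub orb unfolding ys_def[symmetric] by auto
  qed
qed

lemma card_short_cycle_perms_split:
  assumes S: "finite S" "x \<in> S"
  shows "card (short_cycle_perms r S) =
    (\<Sum>ys | length ys < r \<and> distinct ys \<and> set ys \<subseteq> S - {x}. card (short_cycle_perms r (S - set (x # ys))))"
proof -
  have "finite {ys. length ys < r \<and> distinct ys \<and> set ys \<subseteq> S - {x}}"
    by (rule finite_subset[OF _ finite_subset_distinct[of "S - {x}"]]) (use S in auto)
  then have "card (SIGMA ys:{ys. length ys < r \<and> distinct ys \<and> set ys \<subseteq> S - {x}}. short_cycle_perms r (S - set (x # ys)))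
    = (\<Sum>ys | length ys < r \<and> distinct ys \<and> set ys \<subseteq> S - {x}. card (short_cycle_perms r (S - set (x # ys))))"
    by (intro card_SigmaI) (auto intro: S finite_short_cycle_perms)
  then show ?thesis using bij_betw_same_card[OF bij_betw_splice_cycle[OF S, of r]] by simp
qed

text \<open>
There are \<open>(n - 1)! / (n - j)!\<close> lists that can follow \<open>x\<close> in a cycle of length \<open>j\<close>. This factor
turns \<open>(n - j)!\<close> into \<open>(n - 1)!\<close>, so after normalising by factorials all cycle lengths get equal
weight. The sequence \<open>q\<close> is abstract because the same computation is used twice: for \<open>S\<close> and for
the model set \<open>{1..card S}\<close>.
\<close>

lemma card_short_cycle_perms_recurrence:
  assumes S: "finite S" "x \<in> S"
    and A: "\<And>T. T \<subset> S \<Longrightarrow> real (card (short_cycle_perms r T)) = fact (card T) * q (card T)"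
  shows "real (card (short_cycle_perms r S)) =
    fact (card S - 1) * (\<Sum>j=1..min r (card S). q (card S - j))"
proof -
  let ?n = "card S"
  define L where "L = (\<lambda>j. {ys. length ys = j \<and> distinct ys \<and> set ys \<subseteq> S - {x}})"
  have n: "?n \<ge> 1" using S by (metis One_nat_def Suc_leI card_gt_0_iff empty_iff)
  have cS: "card (S - {x}) = ?n - 1" using S by simp
  have len: "length ys \<le> ?n - 1" if "distinct ys" "set ys \<subseteq> S - {x}" for ys
    using card_mono[OF _ that(2)] distinct_card[OF that(1)] S cS by simp
  have finL: "finite (L j)" for j
    unfolding L_def by (rule finite_subset[OF _ finite_subset_distinct[of "S - {x}"]]) (use S in auto)
  have U: "{ys. length ys < r \<and> distinct ys \<and> set ys \<subseteq> S - {x}} = (\<Union>j\<in>{..<min r ?n}. L j)"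
    using len n by (fastforce simp: L_def)
  have summand: "real (card (short_cycle_perms r (S - set (x # ys)))) = fact (?n - Suc j) * q (?n - Suc j)"
    if "ys \<in> L j" for ys j
  proof -
    have d: "distinct (x # ys)" "set (x # ys) \<subseteq> S" "length ys = j" using that S by (auto simp: L_def)
    have "card (S - set (x # ys)) = ?n - Suc j"
      using card_Diff_subset[OF _ d(2)] distinct_card[OF d(1)] d(3) by simp
    moreover have "S - set (x # ys) \<subset> S" using S by auto
    ultimately show ?thesis using A by metis
  qed
  have cardL: "real (card (L j)) * fact (?n - Suc j) = fact (?n - 1)" if "j < ?n" for j
  proof -
    have "card (L j) = \<Prod>{?n - 1 - j + 1..?n - 1}"
      unfolding L_def using card_lists_distinct_length_eq[of "S - {x}" j] S cS that by simp
    also have "\<dots> = fact (?n - 1) div fact (?n - 1 - j)"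
      using fact_div_fact[of "?n - 1 - j" "?n - 1"] by simp
    finally have "card (L j) * fact (?n - Suc j) = fact (?n - 1)"
      using fact_dvd[of "?n - 1 - j" "?n - 1", where 'a=nat] by simp
    then show ?thesis by (metis of_nat_fact of_nat_mult)
  qed
  have "real (card (short_cycle_perms r S)) =
     (\<Sum>ys\<in>(\<Union>j\<in>{..<min r ?n}. L j). real (card (short_cycle_perms r (S - set (x # ys)))))"
    unfolding card_short_cycle_perms_split[OF S] U by simp
  also have "\<dots> = (\<Sum>j<min r ?n. \<Sum>ys\<in>L j. real (card (short_cycle_perms r (S - set (x # ys)))))"
    by (rule sum.UNION_disjoint) (use finL in \<open>auto simp: L_def\<close>)
  also have "\<dots> = (\<Sum>j<min r ?n. \<Sum>ys\<in>L j. fact (?n - Suc j) * q (?n - Suc j))"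
    by (intro sum.cong refl summand) auto 
  also have "\<dots> = (\<Sum>j<min r ?n. fact (?n - 1) * q (?n - Suc j))"
    using cardL by (intro sum.cong refl) (simp add: mult.assoc[symmetric])
  also have "\<dots> = fact (?n - 1) * (\<Sum>j<min r ?n. q (?n - Suc j))" by (simp add: sum_distrib_left)
  also have "(\<Sum>j<min r ?n. q (?n - Suc j)) = (\<Sum>j=1..min r ?n. q (?n - j))"
    using sum.atLeast1_atMost_eq[of "\<lambda>j. q (?n - j)" "min r ?n"] by simp
  finally show ?thesis .
qed

lemma nu_eq_card_short_cycle_perms: "nu n r = real (card (short_cycle_perms r {1..n})) / fact n"
proof -
  have "(\<forall>j\<in>{r+1..n}. cycle_count n \<sigma> j = 0) \<longleftrightarrow> (\<forall>x\<in>{1..n}. card (orbit \<sigma> x) \<le> r)"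
    if "\<sigma> permutes {1..n}" for \<sigma>
  proof -
    have *: "card (orbit \<sigma> x) \<le> n" if "x \<in> {1..n}" for x
      using card_mono[OF _ permutes_orbit_subset[OF \<open>\<sigma> permutes {1..n}\<close> that]] by simp
    have "cycle_count n \<sigma> j = 0 \<longleftrightarrow> (\<forall>x\<in>{1..n}. card (orbit \<sigma> x) \<noteq> j)" for j
      by (auto simp: cycle_count_def)
    then show ?thesis using * by fastforce
  qed
  then have "{\<sigma>. \<sigma> permutes {1..n} \<and> (\<forall>j\<in>{r+1..n}. cycle_count n \<sigma> j = 0)} = short_cycle_perms r {1..n}"
    unfolding short_cycle_perms_def by blast
  then show ?thesis by (simp add: nu_def)
qed

text \<open>
The count depends on the size of the set only: by induction, \<open>S\<close> and \<open>{1..card S}\<close> obey the same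
recurrence.
\<close>

lemma card_short_cycle_perms:
  fixes S :: "nat set"
  shows "finite S \<Longrightarrow> real (card (short_cycle_perms r S)) = fact (card S) * nu (card S) r"
proof (induction "card S" arbitrary: S rule: less_induct)
  case less
  show ?case
  proof (cases "S = {}")
    case True
    then show ?thesis by (simp add: nu_eq_card_short_cycle_perms)
  next
    case False
    then obtain x where x: "x \<in> S" by blast
    have n: "card S \<ge> 1" using less.prems False by (simp add: Suc_leI card_gt_0_iff)
    have 1: "real (card (short_cycle_perms r S)) =
      fact (card S - 1) * (\<Sum>j=1..min r (card S). nu (card S - j) r)"
      by (rule card_short_cycle_perms_recurrence[OF less.prems x])
        (use less in \<open>auto intro: psubset_card_mono finite_subset[of _ S]\<close>)
    have "real (card (short_cycle_perms r {1..card S})) =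
      fact (card {1..card S} - 1) * (\<Sum>j=1..min r (card {1..card S}). nu (card {1..card S} - j) r)"
    proof (rule card_short_cycle_perms_recurrence)
      show "card S \<in> {1..card S}" using n by simp
      show "real (card (short_cycle_perms r T)) = fact (card T) * nu (card T) r" if "T \<subset> {1..card S}" for T
        using less.hyps[of T] psubset_card_mono[OF _ that] finite_subset[of T "{1..card S}"] that by auto
    qed simp
    then show ?thesis using 1 by (simp add: nu_eq_card_short_cycle_perms)
  qed
qed

lemma nu_recurrence:
  assumes "r < n"
  shows "real n * nu n r = (\<Sum>k<r. nu (n - r + k) r)"
proof -
  have "real (card (short_cycle_perms r {1..n})) =
      fact (card {1..n} - 1) * (\<Sum>j=1..min r (card {1..n}). nu (card {1..n} - j) r)"
    by (rule card_short_cycle_perms_recurrence[where x = n])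
      (use assms card_short_cycle_perms finite_subset[of _ "{1..n}"] in auto)
  then have "fact n * nu n r = fact (n - 1) * (\<Sum>j=1..r. nu (n - j) r)"
    using assms by (simp add: card_short_cycle_perms min_def)
  moreover have "fact n = real n * fact (n - 1)" using assms by (simp add: fact_reduce)
  moreover have "(\<Sum>j=1..r. nu (n - j) r) = (\<Sum>k<r. nu (n - r + k) r)"
    by (rule sum.reindex_bij_witness[where i = "\<lambda>k. r - k" and j = "\<lambda>j. r - j"])
      (use assms in auto)
  ultimately show ?thesis by simp
qed

lemma nu_eq_1:
  assumes "n \<le> r"
  shows "nu n r = 1"
proof -
  have "{\<sigma>. \<sigma> permutes {1..n} \<and> (\<forall>j\<in>{r+1..n}. cycle_count n \<sigma> j = 0)} = {\<sigma>. \<sigma> permutes {1..n}}"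
    using assms by auto
  then show ?thesis by (simp add: nu_def card_permutations)
qed

section \<open>Elementary properties of the Dickman function\<close>

text \<open>
Used to argue by the first failure of a strict inequality, which still holds strictly to the left
of that point.
\<close>

lemma first_nonpositive_point:
  fixes f :: "real \<Rightarrow> real"
  assumes cont: "continuous_on {a..} f" and u: "a \<le> u" "f u \<le> 0"
  obtains z where "a \<le> z" "f z \<le> 0" "\<And>t. a \<le> t \<Longrightarrow> t < z \<Longrightarrow> f t > 0"
proof
  let ?Z = "{a..} \<inter> f -` {..0}"
  have "closed ?Z" by (intro continuous_closed_preimage cont) auto
  moreover have bdd: "bdd_below ?Z" by (auto intro: bdd_belowI[of _ a])
  ultimately have "Inf ?Z \<in> ?Z" using u by (intro closed_contains_Inf) auto
  then show "a \<le> Inf ?Z" "f (Inf ?Z) \<le> 0" by auto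
  show "f t > 0" if "a \<le> t" "t < Inf ?Z" for t
    using cInf_lower[OF _ bdd, of t] that by force
qed

lemma DERIV_shift_one:
  fixes f :: "real \<Rightarrow> real"
  assumes "(f has_real_derivative D) (at (x - 1))"
  shows "((\<lambda>x. f (x - 1)) has_real_derivative D) (at x)"
  using assms DERIV_shift[of f D x "-1"] by simp

lemma dickman_continuous: "continuous_on {0..} dickman"
  using is_dickman_dickman by (simp add: is_dickman_def)

lemma dickman_eq_1: "0 \<le> v \<Longrightarrow> v \<le> 1 \<Longrightarrow> dickman v = 1"
  using is_dickman_dickman by (simp add: is_dickman_def)

lemma dickman_DERIV: "v > 1 \<Longrightarrow> (dickman has_real_derivative - dickman (v - 1) / v) (at v)"
  by (rule is_dickman_DERIV[OF is_dickman_dickman])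

definition dickman_primitive :: "real \<Rightarrow> real" where
  "dickman_primitive v = integral {0..v} dickman"

lemma dickman_primitive_DERIV:
  assumes "v > 0"
  shows "(dickman_primitive has_real_derivative dickman v) (at v)"
proof -
  have "continuous_on {0..v + 1} dickman"
    by (rule continuous_on_subset[OF dickman_continuous]) auto
  then have "((\<lambda>x. integral {0..x} dickman) has_real_derivative dickman v) (at v within {0..v + 1})"
    using assms by (intro integral_has_real_derivative) auto
  then show ?thesis
    using assms unfolding dickman_primitive_def[abs_def] by (subst (asm) at_within_interior) auto
qed

lemma dickman_primitive_continuous: "continuous_on {0..} dickman_primitive"
proof -
  have "continuous (at x within {0..}) dickman_primitive" if "x \<ge> 0" for x
  proof (cases "x = 0")
    case True
    have "continuous_on {0..1} dickman"
      by (rule continuous_on_subset[OF dickman_continuous]) auto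
    then have c: "continuous_on {0..1} dickman_primitive"
      unfolding dickman_primitive_def[abs_def]
      by (intro indefinite_integral_continuous_1 integrable_continuous_real)
    have "at x within {0..1} = at x within {0..}"
      using True by (intro at_within_nhd[of _ "{..<1}"]) auto
    then show ?thesis using c True by (metis atLeastAtMost_iff continuous_on_eq_continuous_within order_refl zero_le_one)
  next
    case False
    then show ?thesis
      using that DERIV_isCont[OF dickman_primitive_DERIV] by (simp add: continuous_at_imp_continuous_within)
  qed
  then show ?thesis by (simp add: continuous_on_eq_continuous_within)
qed

lemma dickman_primitive_eq:
  assumes "0 \<le> v" "v \<le> 1"
  shows "dickman_primitive v = v"
proof -
  have "dickman_primitive v = integral {0..v} (\<lambda>_. 1::real)"
    unfolding dickman_primitive_def using assms by (intro integral_cong) (auto simp: dickman_eq_1)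
  then show ?thesis using assms by simp
qed

text \<open>
The integrated form \<open>v \<rho>(v) = \<integral>\<^bsub>v-1\<^esub>\<^bsup>v\<^esup> \<rho>\<close> of the delay equation: both sides have derivative
\<open>\<rho>(v) - \<rho>(v - 1)\<close>, and they agree at \<open>v = 1\<close>. It is the continuous counterpart of the recurrence
for \<open>\<nu>\<close>.
\<close>

lemma dickman_window:
  assumes "v \<ge> 1"
  shows "v * dickman v = dickman_primitive v - dickman_primitive (v - 1)"
proof -
  define f where "f = (\<lambda>x. x * dickman x - (dickman_primitive x - dickman_primitive (x - 1)))"
  have f1: "f 1 = 0" by (simp add: f_def dickman_primitive_eq dickman_eq_1)
  have "f v = f 1"
  proof (cases "v = 1")
    case False
    then have v: "1 < v" using assms by simp
    have "continuous_on {1..v} f"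
      unfolding f_def
      by (intro continuous_intros continuous_on_subset[OF dickman_continuous]
          continuous_on_subset[OF dickman_primitive_continuous]
          continuous_on_compose2[OF dickman_primitive_continuous, of _ "\<lambda>x. x - 1"]) auto
    moreover have "(f has_real_derivative 0) (at x)" if x: "1 < x" "x < v" for x
    proof -
      have "((\<lambda>x. dickman_primitive (x - 1)) has_real_derivative dickman (x - 1)) (at x)"
        using x by (intro DERIV_shift_one dickman_primitive_DERIV) simp
      then show ?thesis
        unfolding f_def using x
        by (auto intro!: derivative_eq_intros dickman_DERIV dickman_primitive_DERIV)
    qed
    ultimately show ?thesis using DERIV_isconst_end[OF v, of f] by blast
  qed simp
  then show ?thesis using f1 by (simp add: f_def)
qed

text \<open>
At a first zero \<open>z\<close> the window integral over \<open>[z - 1, z]\<close> would still be positive.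
\<close>

lemma dickman_pos:
  assumes "v \<ge> 0"
  shows "dickman v > 0"
proof (rule ccontr)
  assume "\<not> dickman v > 0"
  then obtain z where z: "0 \<le> z" "dickman z \<le> 0"
    and before: "\<And>x. 0 \<le> x \<Longrightarrow> x < z \<Longrightarrow> dickman x > 0"
    using \<open>\<not> dickman v > 0\<close> by (auto intro: first_nonpositive_point[OF dickman_continuous assms])
  have z1: "z > 1" using z dickman_eq_1[of z] by force
  have "dickman_primitive (z - 1) < dickman_primitive z"
  proof (rule DERIV_pos_imp_increasing_open[of "z - 1" z])
    show "\<exists>y. (dickman_primitive has_real_derivative y) (at t) \<and> y > 0" if "z - 1 < t" "t < z" for t
      using dickman_primitive_DERIV[of t] before[of t] that z1 by auto
  qed (use z1 in \<open>auto intro!: continuous_on_subset[OF dickman_primitive_continuous]\<close>)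
  then have "z * dickman z > 0" using dickman_window[of z] z1 by simp
  then show False using z z1 by (simp add: zero_less_mult_iff)
qed

lemma dickman_antimono:
  assumes "0 \<le> x" "x \<le> y"
  shows "dickman y \<le> dickman x"
proof -
  have *: "dickman y \<le> dickman x" if "1 \<le> x" "x \<le> y" for x y
  proof (rule DERIV_nonpos_imp_decreasing_open[OF that(2)])
    show "\<exists>z. (dickman has_real_derivative z) (at t) \<and> z \<le> 0" if "x < t" "t < y" for t
      using dickman_DERIV[of t] dickman_pos[of "t - 1"] that \<open>1 \<le> x\<close> by (intro exI) auto
  qed (use that in \<open>auto intro!: continuous_on_subset[OF dickman_continuous]\<close>)
  show ?thesis
    using *[of x y] *[of 1 y] assms dickman_eq_1[of x] dickman_eq_1[of y] dickman_eq_1[of 1]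
    by (cases "y \<le> 1"; cases "x \<le> 1") auto
qed

lemma dickman_le_1: "0 \<le> v \<Longrightarrow> dickman v \<le> 1"
  using dickman_antimono[of 0 v] dickman_eq_1[of 0] by simp

section \<open>Log-concavity of the Dickman function\<close>

text \<open>
The logarithmic decay rate \<open>- \<rho>'(v) / \<rho>(v)\<close> for \<open>v > 1\<close>, written without a derivative by means of
the delay equation.
\<close>

definition dickman_rate :: "real \<Rightarrow> real" where
  "dickman_rate v = dickman (v - 1) / (v * dickman v)"

lemma dickman_rate_pos: "v \<ge> 1 \<Longrightarrow> dickman_rate v > 0"
  using dickman_pos[of v] dickman_pos[of "v - 1"] by (simp add: dickman_rate_def)

lemma dickman_DERIV_rate:
  "v > 1 \<Longrightarrow> (dickman has_real_derivative - dickman_rate v * dickman v) (at v)"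
  using dickman_DERIV[of v] dickman_pos[of v] by (simp add: dickman_rate_def)

lemma dickman_rate_continuous: "continuous_on {1..} dickman_rate"
proof -
  have "x * dickman x \<noteq> 0" if "x \<ge> 1" for x using dickman_pos[of x] that by auto
  then show ?thesis
  unfolding dickman_rate_def[abs_def]
  by (intro continuous_intros continuous_on_subset[OF dickman_continuous]
      continuous_on_compose2[OF dickman_continuous, of _ "\<lambda>x. x - 1"]) auto
qed

lemma dickman_rate_mono_12:
  assumes "1 \<le> x" "x \<le> y" "y \<le> 2"
  shows "dickman_rate x \<le> dickman_rate y"
proof -
  have "y * dickman y \<le> x * dickman x"
  proof (rule DERIV_nonpos_imp_decreasing_open[OF assms(2)])
    show "\<exists>z. ((\<lambda>x. x * dickman x) has_real_derivative z) (at t) \<and> z \<le> 0" if "x < t" "t < y" for t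
    proof -
      have "((\<lambda>x. x * dickman x) has_real_derivative (1 * dickman t + (- dickman (t - 1) / t) * t)) (at t)"
        using that assms by (intro DERIV_mult DERIV_ident dickman_DERIV) auto
      moreover have "dickman t \<le> dickman (t - 1)" using that assms by (intro dickman_antimono) auto
      ultimately show ?thesis using that assms by (intro exI conjI) auto
    qed
  qed (use assms in \<open>auto intro!: continuous_intros continuous_on_subset[OF dickman_continuous]\<close>)
  moreover have "y * dickman y > 0" "x * dickman x > 0"
    using assms dickman_pos by auto
  ultimately show ?thesis using assms
    by (simp add: dickman_rate_def dickman_eq_1 divide_left_mono)
qed

text \<open>
The sign of \<open>dickman_rate v - dickman_rate (v - 1) - 1 / v\<close> decides whether the rate increases.
\<close>

lemma dickman_rate_DERIV:
  assumes "v > 2"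
  shows "(dickman_rate has_real_derivative
    dickman_rate v * (dickman_rate v - dickman_rate (v - 1) - 1 / v)) (at v)"
proof -
  have 1: "((\<lambda>x. dickman (x - 1)) has_real_derivative - dickman_rate (v - 1) * dickman (v - 1)) (at v)"
    using assms by (intro DERIV_shift_one dickman_DERIV_rate) simp
  have 2: "((\<lambda>x. x * dickman x) has_real_derivative dickman v - v * dickman_rate v * dickman v) (at v)"
    using DERIV_mult[OF DERIV_ident dickman_DERIV_rate[of v]] assms by (simp add: algebra_simps)
  have nz: "v * dickman v \<noteq> 0" "dickman v \<noteq> 0" "v \<noteq> 0" using dickman_pos[of v] assms by auto
  have "(dickman_rate has_real_derivative
    ((- dickman_rate (v - 1) * dickman (v - 1)) * (v * dickman v) -
      dickman (v - 1) * (dickman v - v * dickman_rate v * dickman v)) / ((v * dickman v) * (v * dickman v))) (at v)"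
    unfolding dickman_rate_def[abs_def] using DERIV_divide[OF 1 2 nz(1)] by (simp add: dickman_rate_def)
  moreover have "((- a * b) * (v * d) - b * (d - v * w * d)) / ((v * d) * (v * d)) = (b / (v * d)) * (w - a - 1 / v)"
    if "d \<noteq> 0" for a b d w :: real
    using nz that by (simp add: field_simps)
  from this[OF nz(2)] have "((- dickman_rate (v - 1) * dickman (v - 1)) * (v * dickman v) -
      dickman (v - 1) * (dickman v - v * dickman_rate v * dickman v)) / ((v * dickman v) * (v * dickman v))
    = dickman_rate v * (dickman_rate v - dickman_rate (v - 1) - 1 / v)"
    unfolding dickman_rate_def[of v] .
  ultimately show ?thesis by simp
qed

text \<open>
Write \<open>w\<close> for the rate. Integrating \<open>(w s - w (u - 1)) \<rho>(s)\<close> over \<open>[u - 1, u]\<close> gives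
\<open>\<rho>(u - 1) - \<rho>(u) - w (u - 1) u \<rho>(u) = u \<rho>(u) (w u - w (u - 1) - 1 / u)\<close>. If \<open>w\<close> is monotone up to
\<open>u\<close>, the integrand is nonnegative, and even positive near \<open>u\<close>. Thus monotonicity up to \<open>u\<close> forces
\<open>w\<close> to increase strictly at \<open>u\<close>, so it can never stop.
\<close>

lemma dickman_rate_gap:
  assumes u: "u \<ge> 2" and mono: "\<And>x y. 1 \<le> x \<Longrightarrow> x \<le> y \<Longrightarrow> y \<le> u \<Longrightarrow> dickman_rate x \<le> dickman_rate y"
  shows "dickman_rate u - dickman_rate (u - 1) > 1 / u"
proof -
  let ?w = "dickman_rate" and ?w1 = "dickman_rate (u - 1)"
  \<comment> \<open>a primitive of \<open>(w s - w (u - 1)) \<rho>(s)\<close>\<close>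
  define Q where "Q = (\<lambda>s. - dickman s - ?w1 * dickman_primitive s)"
  have Qc: "continuous_on {a..b} Q" if "a \<ge> 0" for a b
    unfolding Q_def using that
    by (intro continuous_intros continuous_on_subset[OF dickman_continuous]
          continuous_on_subset[OF dickman_primitive_continuous]) auto
  have QD: "(Q has_real_derivative dickman s * (?w s - ?w1)) (at s)" if "s > 1" for s
    unfolding Q_def using that
    by (auto intro!: derivative_eq_intros dickman_DERIV_rate dickman_primitive_DERIV simp: algebra_simps)
  have Qm: "Q a \<le> Q b" if "u - 1 \<le> a" "a \<le> b" "b \<le> u" for a b
  proof (rule DERIV_nonneg_imp_increasing_open[OF that(2)])
    show "\<exists>y. (Q has_real_derivative y) (at x) \<and> y \<ge> 0" if "a < x" "x < b" for x
      using QD[of x] mono[of "u - 1" x] dickman_pos[of x] that \<open>u - 1 \<le> a\<close> \<open>b \<le> u\<close> u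
      by (intro exI conjI) auto
  qed (use that u Qc in auto)
  have diff: "Q u - Q (u - 1) = u * dickman u * (?w u - ?w1 - 1 / u)"
  proof -
    have "dickman u > 0" "u > 0" using dickman_pos[of u] u by auto
    then have "u * dickman u * ?w u = dickman (u - 1)" "u * dickman u * (1 / u) = dickman u"
      by (simp_all add: dickman_rate_def[of u])
    then have "u * dickman u * (?w u - ?w1 - 1 / u) = dickman (u - 1) - ?w1 * (u * dickman u) - dickman u"
      by (simp only: right_diff_distrib mult.commute[of ?w1])
    moreover have "u * dickman u = dickman_primitive u - dickman_primitive (u - 1)"
      using dickman_window[of u] u by simp
    moreover have "Q u - Q (u - 1) =
        dickman (u - 1) - ?w1 * (dickman_primitive u - dickman_primitive (u - 1)) - dickman u"
      by (simp add: Q_def algebra_simps)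
    ultimately show ?thesis by simp
  qed
  have pos: "u * dickman u > 0" using dickman_pos[of u] u by simp
  then have "?w u - ?w1 - 1 / u \<ge> 0"
    using diff Qm[of "u - 1" u] by (smt (verit) zero_le_mult_iff)
  \<comment> \<open>The weak inequality already separates \<open>w u\<close> from \<open>w (u - 1)\<close>; by continuity the integrand is
    positive on some \<open>[s, u]\<close>, which upgrades it to a strict one.\<close>
  then have gt: "?w u > ?w1" using u by (smt (verit) divide_pos_pos)
  have "\<exists>s. u - 1 \<le> s \<and> s < u \<and> ?w s > ?w1"
  proof -
    have "continuous_on {u - 1..u} ?w"
      by (rule continuous_on_subset[OF dickman_rate_continuous]) (use u in auto)
    then obtain s where "u - 1 \<le> s" "s \<le> u" "?w s = (?w u + ?w1) / 2"
      using IVT'[of ?w "u - 1" "(?w u + ?w1) / 2" u] gt by auto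
    then show ?thesis using gt by (intro exI[of _ s]) (auto simp: field_simps less_le)
  qed
  then obtain s where s: "u - 1 \<le> s" "s < u" "?w s > ?w1" by blast
  have "Q s < Q u"
  proof (rule DERIV_pos_imp_increasing_open[OF s(2)])
    show "\<exists>y. (Q has_real_derivative y) (at x) \<and> y > 0" if "s < x" "x < u" for x
      using QD[of x] mono[of s x] dickman_pos[of x] that s u
      by (intro exI[of _ "dickman x * (?w x - ?w1)"]) auto
  qed (use s u Qc in auto)
  then have "Q u - Q (u - 1) > 0" using Qm[of "u - 1" s] s by simp
  then have "?w u - ?w1 - 1 / u > 0" using diff pos by (simp add: zero_less_mult_iff)
  then show ?thesis by simp
qed

text \<open>
Log-concavity of \<open>\<rho>\<close>. On \<open>[1, 2]\<close> the rate is \<open>1 / (v \<rho>(v))\<close> with a decreasing denominator. Beyond \<open>2\<close>, at the first point where the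
derivative of the rate fails to be positive the rate would be monotone up to that point, which
contradicts the previous lemma.
\<close>

lemma dickman_rate_mono:
  assumes "1 \<le> x" "x \<le> y"
  shows "dickman_rate x \<le> dickman_rate y"
proof -
  let ?w = dickman_rate
  define h where "h = (\<lambda>u. ?w u - ?w (u - 1) - 1 / u)"
  have hc: "continuous_on {2..} h"
    unfolding h_def
    by (intro continuous_intros continuous_on_subset[OF dickman_rate_continuous]
        continuous_on_compose2[OF dickman_rate_continuous, of _ "\<lambda>x. x - 1"]) auto
  have up: "?w x \<le> ?w y" if hpos: "\<And>t. 2 \<le> t \<Longrightarrow> t < b \<Longrightarrow> h t \<ge> 0" and xy: "1 \<le> x" "x \<le> y" "y \<le> b"
    for b x y
  proof -
    have *: "?w x \<le> ?w y" if "2 \<le> x" "x \<le> y" "y \<le> b" for x y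
    proof (rule DERIV_nonneg_imp_increasing_open[OF that(2)])
      show "\<exists>z. (?w has_real_derivative z) (at t) \<and> z \<ge> 0" if "x < t" "t < y" for t
        using dickman_rate_DERIV[of t] hpos[of t] dickman_rate_pos[of t] that \<open>2 \<le> x\<close> \<open>y \<le> b\<close>
        by (intro exI conjI) (auto simp: h_def)
    qed (use that in \<open>auto intro!: continuous_on_subset[OF dickman_rate_continuous]\<close>)
    consider "y \<le> 2" | "2 \<le> x" | "x \<le> 2" "2 \<le> y" by linarith
    then show ?thesis
    proof cases
      case 3
      then show ?thesis using *[of 2 y] dickman_rate_mono_12[of x 2] xy by simp
    qed (use * dickman_rate_mono_12 xy in auto)
  qed
  have "h u > 0" if u2: "u \<ge> 2" for u
  proof (rule ccontr)
    assume "\<not> h u > 0"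
    then obtain z where z: "2 \<le> z" "h z \<le> 0" and "\<And>t. 2 \<le> t \<Longrightarrow> t < z \<Longrightarrow> h t > 0"
      using \<open>\<not> h u > 0\<close> by (auto intro: first_nonpositive_point[OF hc u2])
    then have before: "\<And>t. 2 \<le> t \<Longrightarrow> t < z \<Longrightarrow> h t \<ge> 0" by (simp add: less_imp_le)
    have "h z > 0" using dickman_rate_gap[of z] up[OF before] z by (auto simp: h_def)
    then show False using z by simp
  qed
  then show ?thesis using up[of y x y] assms by force
qed

section \<open>The saddle point function\<close>

text \<open>
The map \<open>(e\<^sup>x - 1) / x\<close> inverts \<open>\<xi>\<close>. It equals \<open>e\<^bsup>x/2\<^esup>\<close> times \<open>sinh (x/2) / (x/2)\<close>, and the second
factor increases; so the map grows at least like \<open>e\<^bsup>x/2\<^esup>\<close>, which makes \<open>\<xi>\<close> a slowly varying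
function.
\<close>

lemma exp_minus_1_over_growth:
  fixes x y :: real
  assumes "0 < x" "x \<le> y"
  shows "(exp x - 1) / x * exp ((y - x) / 2) \<le> (exp y - 1) / y"
proof -
  \<comment> \<open>\<open>g\<close> is \<open>2 sinh (t/2) / t\<close>, and \<open>k\<close> is the numerator of its derivative\<close>
  define k where "k = (\<lambda>t::real. (exp (t/2) + exp (-t/2)) / 2 * t - (exp (t/2) - exp (-t/2)))"
  define g where "g = (\<lambda>t::real. (exp (t/2) - exp (-t/2)) / t)"
  have k: "k t \<ge> 0" if "t > 0" for t
  proof -
    have "k 0 \<le> k t"
    proof (rule DERIV_nonneg_imp_increasing_open[of 0 t])
      show "\<exists>y. (k has_real_derivative y) (at s) \<and> y \<ge> 0" if "0 < s" "s < t" for s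
      proof (intro exI conjI)
        show "(k has_real_derivative (exp (s/2) - exp (-s/2)) / 4 * s) (at s)"
          unfolding k_def by (auto intro!: derivative_eq_intros simp: field_simps)
        show "(exp (s/2) - exp (-s/2)) / 4 * s \<ge> 0" using that by simp
      qed
    qed (use that in \<open>auto simp: k_def intro!: continuous_intros\<close>)
    then show ?thesis by (simp add: k_def)
  qed
  have "g x \<le> g y"
  proof (rule DERIV_nonneg_imp_increasing_open[OF assms(2)])
    show "\<exists>y. (g has_real_derivative y) (at s) \<and> y \<ge> 0" if "x < s" "s < y" for s
    proof (intro exI conjI)
      show "(g has_real_derivative k s / s\<^sup>2) (at s)"
        unfolding g_def k_def using that assms
        by (auto intro!: derivative_eq_intros simp: field_simps power2_eq_square)
      show "k s / s\<^sup>2 \<ge> 0" using k[of s] that assms by simp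
    qed
  qed (use assms in \<open>auto simp: g_def intro!: continuous_intros\<close>)
  moreover have "(exp t - 1) / t = g t * exp (t/2)" for t
    by (simp add: g_def left_diff_distrib flip: exp_add)
  moreover have "exp (x/2) * exp ((y - x) / 2) = exp (y/2)"
    by (simp add: diff_divide_distrib flip: exp_add)
  ultimately show ?thesis by (simp add: mult.assoc)
qed

lemma exp_minus_1_over_xi: "v > 1 \<Longrightarrow> (exp (xi v) - 1) / xi v = v"
  using xi_props[of v] by simp

lemma xi_leI:
  assumes "v > 1" "x > 0" "1 + v * x \<le> exp x"
  shows "xi v \<le> x"
proof (rule ccontr)
  assume "\<not> xi v \<le> x"
  then have lt: "x < xi v" by simp
  have "v \<le> (exp x - 1) / x" using assms by (simp add: field_simps)
  then have "v * exp ((xi v - x) / 2) \<le> (exp x - 1) / x * exp ((xi v - x) / 2)"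
    by (intro mult_right_mono) auto
  also have "\<dots> \<le> v"
    using exp_minus_1_over_growth[of x "xi v"] exp_minus_1_over_xi[of v] assms lt by simp
  finally have "exp ((xi v - x) / 2) \<le> 1" using assms by (simp add: mult_le_cancel_left1)
  then show False using lt by simp
qed

lemma le_xiI:
  assumes "v > 1" "x > 0" "exp x \<le> 1 + v * x"
  shows "x \<le> xi v"
proof (rule ccontr)
  assume "\<not> x \<le> xi v"
  then have lt: "xi v < x" by simp
  have "v * exp ((x - xi v) / 2) \<le> (exp x - 1) / x"
    using exp_minus_1_over_growth[of "xi v" x] exp_minus_1_over_xi[of v] xi_props[of v] assms lt by simp
  also have "\<dots> \<le> v" using assms by (simp add: field_simps)
  finally have "exp ((x - xi v) / 2) \<le> 1" using assms by (simp add: mult_le_cancel_left1)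
  then show False using lt by simp
qed

lemma xi_mono: "1 < a \<Longrightarrow> a \<le> b \<Longrightarrow> xi a \<le> xi b"
  using xi_props[of a] by (intro le_xiI) (auto intro: mult_right_mono)

text \<open>
The growth of the inverse map gives \<open>b / a \<ge> exp ((\<xi>(b) - \<xi>(a)) / 2) \<ge> 1 + (\<xi>(b) - \<xi>(a)) / 2\<close>.
\<close>

lemma xi_lipschitz:
  assumes "1 < a" "a \<le> b"
  shows "xi b - xi a \<le> 2 * (b - a) / a"
proof -
  have "a * (1 + (xi b - xi a) / 2) \<le> a * exp ((xi b - xi a) / 2)"
    using exp_ge_add_one_self[of "(xi b - xi a) / 2"] assms by (intro mult_left_mono) auto
  also have "\<dots> \<le> b"
    using exp_minus_1_over_growth[of "xi a" "xi b"] exp_minus_1_over_xi[of a] exp_minus_1_over_xi[of b]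
      xi_props[of a] xi_mono[of a b] assms by simp
  finally show ?thesis using assms by (simp add: field_simps)
qed

lemma xi_le_ln:
  assumes "v > 1"
  shows "xi v \<le> 2 * ln v"
proof (rule xi_leI)
  define k where "k = (\<lambda>t::real. t - 1 / t - 2 * ln t)"
  have "k 1 \<le> k v"
  proof (rule DERIV_nonneg_imp_increasing_open[of 1 v])
    show "\<exists>y. (k has_real_derivative y) (at t) \<and> y \<ge> 0" if "1 < t" "t < v" for t
    proof (intro exI conjI)
      show "(k has_real_derivative (1 - 1 / t)\<^sup>2) (at t)"
        unfolding k_def using that
        by (auto intro!: derivative_eq_intros simp: field_simps power2_eq_square)
    qed simp
  qed (use assms in \<open>auto simp: k_def intro!: continuous_intros\<close>)
  then have "2 * ln v \<le> v - 1 / v" by (simp add: k_def)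
  then have "v * (2 * ln v) \<le> v * (v - 1 / v)" using assms by (intro mult_left_mono) auto
  also have "\<dots> = v\<^sup>2 - 1" using assms by (simp add: algebra_simps power2_eq_square)
  also have "v\<^sup>2 = exp (2 * ln v)" unfolding exp_double using assms by simp
  finally show "1 + v * (2 * ln v) \<le> exp (2 * ln v)" by simp
qed (use assms in auto)

section \<open>The decay rate and the saddle point function\<close>

text \<open>
Since the rate is monotone, to the left of \<open>v\<close> the function \<open>\<rho>\<close> lies below the exponential that
touches it at \<open>v\<close>; to the left of \<open>1\<close> the rate is \<open>0\<close>, which only helps. The next lemma is the
matching lower bound.
\<close>

lemma dickman_le_exp:
  assumes v: "v > 1" and s: "0 \<le> s" "s \<le> v"
  shows "dickman s \<le> dickman v * exp (dickman_rate v * (v - s))"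
proof -
  let ?w = "dickman_rate v"
  define G where "G = (\<lambda>s. dickman s * exp (?w * s))"
  have mono: "G a \<le> G v" if "1 \<le> a" "a \<le> v" for a
  proof (rule DERIV_nonneg_imp_increasing_open[OF that(2)])
    show "\<exists>y. (G has_real_derivative y) (at t) \<and> y \<ge> 0" if "a < t" "t < v" for t
    proof (intro exI conjI)
      show "(G has_real_derivative exp (?w * t) * dickman t * (?w - dickman_rate t)) (at t)"
        unfolding G_def using that \<open>1 \<le> a\<close>
        by (auto intro!: derivative_eq_intros dickman_DERIV_rate simp: algebra_simps)
      show "exp (?w * t) * dickman t * (?w - dickman_rate t) \<ge> 0"
        using dickman_pos[of t] dickman_rate_mono[of t v] that \<open>1 \<le> a\<close> by simp
    qed
  qed (use that in \<open>auto simp: G_def intro!: continuous_intros continuous_on_subset[OF dickman_continuous]\<close>)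
  have "G s \<le> G v"
  proof (cases "s \<le> 1")
    case True
    then have "G s \<le> G 1"
      using s dickman_rate_pos[of v] v by (simp add: G_def dickman_eq_1)
    then show ?thesis using mono[of 1] v by simp
  next
    case False
    then show ?thesis using mono s by simp
  qed
  then have "G s * exp (- ?w * s) \<le> G v * exp (- ?w * s)" by (intro mult_right_mono) auto
  then show ?thesis
    by (simp add: G_def mult.assoc right_diff_distrib flip: exp_add)
qed

lemma exp_le_dickman:
  assumes v: "v \<ge> 1" and s: "v \<le> s" "s \<le> z"
  shows "dickman z * exp (dickman_rate v * (z - s)) \<le> dickman s"
proof -
  let ?w = "dickman_rate v"
  define G where "G = (\<lambda>s. dickman s * exp (?w * s))"
  have "G z \<le> G s"
  proof (rule DERIV_nonpos_imp_decreasing_open[OF s(2)])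
    show "\<exists>y. (G has_real_derivative y) (at t) \<and> y \<le> 0" if "s < t" "t < z" for t
    proof (intro exI conjI)
      show "(G has_real_derivative exp (?w * t) * dickman t * (?w - dickman_rate t)) (at t)"
        unfolding G_def using that v s
        by (auto intro!: derivative_eq_intros dickman_DERIV_rate simp: algebra_simps)
      show "exp (?w * t) * dickman t * (?w - dickman_rate t) \<le> 0"
        using dickman_pos[of t] dickman_rate_mono[of v t] that v s by (simp add: mult_le_0_iff)
    qed
  qed (use v s in \<open>auto simp: G_def intro!: continuous_intros continuous_on_subset[OF dickman_continuous]\<close>)
  then have "G z * exp (- ?w * s) \<le> G s * exp (- ?w * s)" by (intro mult_right_mono) auto
  then show ?thesis
    by (simp add: G_def mult.assoc right_diff_distrib flip: exp_add)
qed

text \<open>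
If the rate were a constant \<open>w\<close> on the window, the identity \<open>v \<rho>(v) = \<integral>\<^bsub>v-1\<^esub>\<^bsup>v\<^esup> \<rho>\<close> would read
\<open>v = (e\<^sup>w - 1) / w\<close>, that is \<open>w = \<xi>(v)\<close>. As the rate is monotone, replacing it on the window
\<open>[v - 1, v]\<close> by its value at the right end gives \<open>\<xi>(v) \<le> dickman_rate v\<close>, and replacing it on
\<open>[v, v + 1]\<close> by its value at the left end gives \<open>dickman_rate v \<le> \<xi>(v + 1)\<close>.
\<close>

lemma xi_le_dickman_rate:
  assumes v: "v > 1"
  shows "xi v \<le> dickman_rate v"
proof -
  let ?w = "dickman_rate v"
  have w: "?w > 0" using dickman_rate_pos v by simp
  have \<rho>: "dickman v > 0" using dickman_pos v by simp
  define H where "H = (\<lambda>s. dickman_primitive s + dickman v * exp (?w * (v - s)) / ?w)"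
  have "H v \<le> H (v - 1)"
  proof (rule DERIV_nonpos_imp_decreasing_open[of "v - 1" v])
    show "\<exists>y. (H has_real_derivative y) (at t) \<and> y \<le> 0" if "v - 1 < t" "t < v" for t
    proof (intro exI conjI)
      show "(H has_real_derivative dickman t - dickman v * exp (?w * (v - t))) (at t)"
        unfolding H_def using that v w
        by (auto intro!: derivative_eq_intros dickman_primitive_DERIV)
      show "dickman t - dickman v * exp (?w * (v - t)) \<le> 0"
        using dickman_le_exp[of v t] that v by simp
    qed
  qed (use v w in \<open>auto simp: H_def intro!: continuous_intros continuous_on_subset[OF dickman_primitive_continuous]\<close>)
  then have "v * dickman v \<le> dickman v * (exp ?w - 1) / ?w"
    using dickman_window[of v] v by (simp add: H_def diff_divide_distrib right_diff_distrib)
  then have "v * dickman v * ?w \<le> dickman v * (exp ?w - 1)" using w by (simp add: field_simps)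
  then have "dickman v * (v * ?w) \<le> dickman v * (exp ?w - 1)" by (simp add: algebra_simps)
  then have "v * ?w \<le> exp ?w - 1" using \<rho> by simp
  then show ?thesis using v w by (intro xi_leI) auto
qed

lemma dickman_rate_le_xi:
  assumes v: "v \<ge> 1"
  shows "dickman_rate v \<le> xi (v + 1)"
proof -
  let ?w = "dickman_rate v" and ?z = "v + 1"
  have w: "?w > 0" using dickman_rate_pos v by simp
  have \<rho>: "dickman ?z > 0" using dickman_pos v by simp
  define H where "H = (\<lambda>s. dickman_primitive s + dickman ?z * exp (?w * (?z - s)) / ?w)"
  have "H v \<le> H ?z"
  proof (rule DERIV_nonneg_imp_increasing_open[of v ?z])
    show "\<exists>y. (H has_real_derivative y) (at t) \<and> y \<ge> 0" if "v < t" "t < ?z" for t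
    proof (intro exI conjI)
      show "(H has_real_derivative dickman t - dickman ?z * exp (?w * (?z - t))) (at t)"
        unfolding H_def using that v w
        by (auto intro!: derivative_eq_intros dickman_primitive_DERIV)
      show "dickman t - dickman ?z * exp (?w * (?z - t)) \<ge> 0"
        using exp_le_dickman[of v t ?z] that v by simp
    qed
  qed (use v w in \<open>auto simp: H_def intro!: continuous_intros continuous_on_subset[OF dickman_primitive_continuous]\<close>)
  then have "dickman ?z * (exp ?w - 1) / ?w \<le> ?z * dickman ?z"
    using dickman_window[of ?z] v by (simp add: H_def diff_divide_distrib right_diff_distrib[of "dickman _"])
  then have "dickman ?z * (exp ?w - 1) \<le> ?z * dickman ?z * ?w" using w by (simp add: field_simps)
  then have "dickman ?z * (exp ?w - 1) \<le> dickman ?z * (?z * ?w)" by (simp add: algebra_simps)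
  then have "exp ?w - 1 \<le> ?z * ?w" using \<rho> by simp
  then show ?thesis using v w by (intro le_xiI) auto
qed

section \<open>Sampling the Dickman function on a grid\<close>

lemma MVT_DERIV:
  fixes f :: "real \<Rightarrow> real"
  assumes "a < b" "continuous_on {a..b} f"
    and f': "\<And>x. a < x \<Longrightarrow> x < b \<Longrightarrow> (f has_real_derivative f' x) (at x)"
  obtains c where "a < c" "c < b" "f b - f a = (b - a) * f' c"
proof -
  obtain l c where "a < c" "c < b" "(f has_real_derivative l) (at c)" "f b - f a = (b - a) * l"
    using MVT[OF assms(1,2)] f' real_differentiable_def by metis
  then show thesis using that[of c] DERIV_unique[OF f'[of c], of l] by simp
qed

text \<open>
A nonincreasing majorant of \<open>\<bar>\<rho>'\<bar>\<close>, equal to \<open>- \<rho>'\<close> to the right of \<open>1\<close>. The value \<open>2\<close> to the left of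
\<open>1\<close>, where \<open>\<rho>\<close> is constant, is chosen so that the majorant drops by at least \<open>1\<close> across \<open>1\<close>. This pays
for the kink of \<open>\<rho>\<close> there, and quadrature errors can be bounded by differences of this function on
every interval.
\<close>

definition dickman_slope :: "real \<Rightarrow> real" where
  "dickman_slope x = (if x < 1 then 2 else dickman (x - 1) / x)"

lemma dickman_slope_nonneg: "dickman_slope x \<ge> 0"
  using dickman_pos[of "x - 1"] by (cases "x < 1") (simp_all add: dickman_slope_def)

lemma dickman_slope_le_1: "x \<ge> 1 \<Longrightarrow> dickman_slope x \<le> 1"
  using dickman_le_1[of "x - 1"] by (simp add: dickman_slope_def)

lemma dickman_slope_antimono:
  assumes "x \<le> y"
  shows "dickman_slope y \<le> dickman_slope x"
proof (cases "x < 1")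
  case True
  have "dickman_slope y \<le> 2"
    using dickman_slope_le_1[of y] by (cases "y < 1") (simp add: dickman_slope_def, linarith)
  then show ?thesis using True by (simp add: dickman_slope_def[of x])
next
  case False
  then have "dickman (y - 1) / y \<le> dickman (x - 1) / x"
    using assms dickman_antimono[of "x - 1" "y - 1"] dickman_pos[of "x - 1"]
    by (intro frac_le) auto
  then show ?thesis using False assms by (simp add: dickman_slope_def)
qed

lemma dickman_diff_between_slopes:
  assumes "1 \<le> x" "x \<le> y"
  shows "dickman x - dickman y \<in> {dickman_slope y * (y - x)..dickman_slope x * (y - x)}"
proof (cases "x = y")
  case False
  then have "x < y" using assms by simp
  moreover have "continuous_on {x..y} dickman"
    using assms by (intro continuous_on_subset[OF dickman_continuous]) auto
  moreover have "(dickman has_real_derivative - dickman_slope t) (at t)" if "x < t" "t < y" for t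
    using dickman_DERIV[of t] that assms by (simp add: dickman_slope_def)
  ultimately obtain c where c: "x < c" "c < y" "dickman y - dickman x = (y - x) * (- dickman_slope c)"
    by (rule MVT_DERIV)
  then have "dickman x - dickman y = dickman_slope c * (y - x)" by (simp add: algebra_simps)
  then show ?thesis
    using c dickman_slope_antimono[of x c] dickman_slope_antimono[of c y] by (auto intro!: mult_right_mono)
qed simp

lemma dickman_diff_le:
  assumes "0 \<le> x" "x \<le> y"
  shows "dickman x - dickman y \<le> y - x"
proof -
  have *: "dickman x - dickman y \<le> y - x" if "1 \<le> x" "x \<le> y" for x y
    using dickman_diff_between_slopes[OF that] dickman_slope_le_1[OF that(1)] that
      mult_right_mono[of "dickman_slope x" 1 "y - x"] by auto
  show ?thesis
    using *[of x y] *[of 1 y] assms dickman_eq_1[of x] dickman_eq_1[of y] dickman_eq_1[of 1]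
    by (cases "y \<le> 1"; cases "x \<le> 1") auto
qed

lemma dickman_diff_le_slope:
  assumes "0 \<le> x" "x \<le> y"
  shows "dickman x - dickman y \<le> dickman_slope x * (y - x)"
  using dickman_diff_between_slopes[of x y] dickman_diff_le[OF assms] assms
  by (cases "x < 1") (auto simp: dickman_slope_def)

text \<open>
To the right of \<open>1\<close> the function \<open>\<rho>\<close> is convex with slopes between the two values of
\<open>- dickman_slope\<close>. If the interval contains \<open>1\<close>, the Lipschitz constant \<open>1\<close> of \<open>\<rho>\<close> suffices, because
\<open>dickman_slope\<close> drops by at least \<open>1\<close>. To the left of \<open>1\<close> everything vanishes.
\<close>

lemma dickman_second_difference:
  assumes t: "0 \<le> t" "t \<le> d" and a: "d \<le> a"
  shows "\<bar>dickman (a + t) + dickman (a - t) - 2 * dickman a\<bar> \<le> d * (dickman_slope (a - d) - dickman_slope (a + d))"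
proof -
  consider "a - d \<ge> 1" | "a - d < 1" "a + d \<ge> 1" | "a + d < 1" by linarith
  then show ?thesis
  proof cases
    case 1
    have "dickman (a - t) - dickman a \<in> {dickman_slope a * t..dickman_slope (a - t) * t}"
      using dickman_diff_between_slopes[of "a - t" a] 1 t by simp
    moreover have "dickman a - dickman (a + t) \<in> {dickman_slope (a + t) * t..dickman_slope a * t}"
      using dickman_diff_between_slopes[of a "a + t"] 1 t by simp
    moreover have "t * (dickman_slope (a - t) - dickman_slope (a + t)) \<le> d * (dickman_slope (a - d) - dickman_slope (a + d))"
      using t dickman_slope_antimono[of "a - d" "a - t"] dickman_slope_antimono[of "a + t" "a + d"]
        dickman_slope_antimono[of "a - t" "a + t"]
      by (intro mult_mono) auto
    ultimately show ?thesis by (auto simp: algebra_simps)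
  next
    case 2
    have "d * 1 \<le> d * (dickman_slope (a - d) - dickman_slope (a + d))"
      using 2 t dickman_slope_le_1[of "a + d"] by (intro mult_left_mono) (auto simp: dickman_slope_def[of "a - d"])
    moreover have "dickman (a - t) - dickman a \<in> {0..t}" "dickman a - dickman (a + t) \<in> {0..t}"
      using dickman_diff_le[of "a - t" a] dickman_diff_le[of a "a + t"] t a
        dickman_antimono[of "a - t" a] dickman_antimono[of a "a + t"] by auto
    ultimately show ?thesis using t by auto
  next
    case 3
    then show ?thesis using t a by (simp add: dickman_eq_1 dickman_slope_def)
  qed
qed

text \<open>
The error is a difference of slopes, so the errors of adjacent cells telescope.
\<close>

lemma dickman_midpoint_rule:
  assumes d: "0 < d" "d \<le> a"
  shows "\<bar>dickman_primitive (a + d) - dickman_primitive (a - d) - 2 * d * dickman a\<bar>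
    \<le> d\<^sup>2 * (dickman_slope (a - d) - dickman_slope (a + d))"
proof -
  define g where "g = (\<lambda>t. dickman_primitive (a + t) - dickman_primitive (a - t) - 2 * t * dickman a)"
  have "continuous_on {0..d} g"
    unfolding g_def
    by (intro continuous_intros continuous_on_compose2[OF dickman_primitive_continuous]) (use d in auto)
  moreover have "(g has_real_derivative dickman (a + t) + dickman (a - t) - 2 * dickman a) (at t)"
    if "0 < t" "t < d" for t
    unfolding g_def using that d
    by (auto intro!: derivative_eq_intros DERIV_chain2[OF dickman_primitive_DERIV])
  ultimately obtain t where t: "0 < t" "t < d"
    "g d - g 0 = (d - 0) * (dickman (a + t) + dickman (a - t) - 2 * dickman a)"
    by (rule MVT_DERIV[OF d(1)])
  have "\<bar>g d\<bar> = d * \<bar>dickman (a + t) + dickman (a - t) - 2 * dickman a\<bar>"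
    using t d by (simp add: abs_mult g_def)
  also have "\<dots> \<le> d * (d * (dickman_slope (a - d) - dickman_slope (a + d)))"
    using dickman_second_difference[of t d a] t d by (intro mult_left_mono) auto
  finally show ?thesis by (simp add: g_def power2_eq_square mult.assoc)
qed

lemma dickman_endpoint_rule:
  assumes d: "0 < d" "d \<le> v"
  shows "\<bar>dickman_primitive v - dickman_primitive (v - d) - d * dickman v\<bar> \<le> d\<^sup>2 * dickman_slope (v - d)"
proof -
  have "continuous_on {v - d..v} dickman_primitive"
    using d by (intro continuous_on_subset[OF dickman_primitive_continuous]) auto
  moreover have "(dickman_primitive has_real_derivative dickman x) (at x)" if "v - d < x" "x < v" for x
    using that d by (intro dickman_primitive_DERIV) simp
  ultimately obtain c where c: "v - d < c" "c < v"
    "dickman_primitive v - dickman_primitive (v - d) = d * dickman c"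
    using d by (auto intro: MVT_DERIV[of "v - d" v dickman_primitive dickman])
  have "dickman c - dickman v \<le> dickman_slope c * (v - c)" using dickman_diff_le_slope[of c v] c d by simp
  also have "\<dots> \<le> dickman_slope (v - d) * d"
    using c d dickman_slope_antimono[of "v - d" c] dickman_slope_nonneg by (intro mult_mono) auto
  finally have "d * (dickman c - dickman v) \<le> d * (dickman_slope (v - d) * d)"
    using d by (intro mult_left_mono) auto
  moreover have "dickman c - dickman v \<ge> 0" using dickman_antimono[of c v] c d by simp
  then have "d * (dickman c - dickman v) \<ge> 0" using d by simp
  ultimately show ?thesis unfolding c(3) by (simp add: algebra_simps power2_eq_square)
qed

text \<open>
The half-integer shifts make the grid fit the delay equation. If \<open>v\<close> is the argument for \<open>m = n\<close>,
then \<open>[v - 1, v]\<close> consists of the \<open>r\<close> cells of width \<open>1 / (r + 1/2)\<close> centred at the arguments for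
\<open>n - r, \<dots>, n - 1\<close>, and of a half cell ending at \<open>v\<close>.
\<close>

definition dickman_at :: "nat \<Rightarrow> nat \<Rightarrow> real" where
  "dickman_at r m = dickman ((real m + 1/2) / (real r + 1/2))"

lemma dickman_at_pos: "dickman_at r m > 0"
  unfolding dickman_at_def by (intro dickman_pos) simp

lemma dickman_at_antimono: "m \<le> n \<Longrightarrow> dickman_at r n \<le> dickman_at r m"
  unfolding dickman_at_def by (intro dickman_antimono divide_right_mono) auto

lemma dickman_at_eq_1: "m \<le> r \<Longrightarrow> dickman_at r m = 1"
  unfolding dickman_at_def by (intro dickman_eq_1) auto

text \<open>
Up to a small error, the sampled Dickman function satisfies the recurrence of \<open>\<nu>\<close>. Scaled by \<open>R\<close>, the half
cell at \<open>v\<close> contributes about \<open>dickman_at r n / 2\<close>, which is the excess of \<open>n + 1/2\<close> over \<open>n\<close> in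
\<open>(n + 1/2) \<rho>(v)\<close>.
\<close>

lemma dickman_at_recurrence:
  assumes n: "r < n"
  defines "R \<equiv> real r + 1/2"
  shows "\<bar>real n * dickman_at r n - (\<Sum>k<r. dickman_at r (n - r + k))\<bar>
    \<le> dickman_slope (real (n - r) / R) / (2 * R)"
proof -
  define d where "d = 1 / (2 * R)"
  define v where "v = (real n + 1/2) / R"
  define p where "p = (\<lambda>m::nat. dickman_primitive (real m / R))"
  define s where "s = (\<lambda>m::nat. dickman_slope (real m / R))"
  define q where "q = (\<lambda>k. n - r + k)"
  have q: "q (Suc k) = Suc (q k)" "q r = n" "q 0 = n - r" for k
    using n by (simp_all add: q_def)
  have R: "R > 0" by (simp add: R_def)
  have d: "d > 0" "R * d\<^sup>2 = 1 / (4 * R)" "R * d = 1/2"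
    using R by (simp_all add: d_def power2_eq_square)
  have "v - 1 = (real n + 1/2 - R) / R" using R by (simp add: v_def diff_divide_distrib)
  also have "real n + 1/2 - R = real (n - r)" using n by (simp add: R_def)
  finally have v1: "v - 1 = real (n - r) / R" .
  have vd: "v - d = real n / R" by (simp add: v_def d_def add_divide_distrib)
  have v: "v \<ge> 1" using n R by (simp add: v_def R_def)
  have s_le: "s n \<le> s (n - r)" "s n \<ge> 0" unfolding s_def
    using dickman_slope_antimono[of "real (n - r) / R" "real n / R"] R dickman_slope_nonneg
    by (auto simp: divide_right_mono)
  have mid: "\<bar>R * (p (Suc m) - p m) - dickman_at r m\<bar> \<le> (s m - s (Suc m)) / (4 * R)" for m
  proof -
    define a where "a = (real m + 1/2) / R"
    have a: "a + d = real (Suc m) / R" "a - d = real m / R"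
      using R by (simp_all add: a_def d_def field_simps)
    have "d \<le> a" using a(2) R by (metis diff_ge_0_iff_ge divide_nonneg_pos of_nat_0_le_iff)
    then have "\<bar>p (Suc m) - p m - 2 * d * dickman a\<bar> \<le> d\<^sup>2 * (s m - s (Suc m))"
      using dickman_midpoint_rule[OF d(1), of a] unfolding a p_def s_def by simp
    then have "R * \<bar>p (Suc m) - p m - 2 * d * dickman a\<bar> \<le> R * (d\<^sup>2 * (s m - s (Suc m)))"
      using R by (intro mult_left_mono) auto
    also have "R * \<bar>p (Suc m) - p m - 2 * d * dickman a\<bar> = \<bar>R * (p (Suc m) - p m) - 2 * (R * d) * dickman a\<bar>"
      using R by (simp add: abs_mult_pos' algebra_simps)
    also have "R * (d\<^sup>2 * (s m - s (Suc m))) = (s m - s (Suc m)) / (4 * R)"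
      using d(2) by (simp add: mult.assoc[symmetric])
    finally show ?thesis unfolding d(3) by (simp add: dickman_at_def a_def R_def[symmetric])
  qed
  have "\<bar>R * (p n - p (n - r)) - (\<Sum>k<r. dickman_at r (q k))\<bar> =
      \<bar>\<Sum>k<r. R * (p (Suc (q k)) - p (q k)) - dickman_at r (q k)\<bar>"
    using sum_lessThan_telescope[of "\<lambda>k. p (q k)" r] unfolding q
    by (simp add: sum_subtractf sum_distrib_left[symmetric])
  also have "\<dots> \<le> (\<Sum>k<r. \<bar>R * (p (Suc (q k)) - p (q k)) - dickman_at r (q k)\<bar>)" by (rule sum_abs)
  also have "\<dots> \<le> (\<Sum>k<r. (s (q k) - s (Suc (q k))) / (4 * R))" by (intro sum_mono mid)
  also have "\<dots> = (s (n - r) - s n) / (4 * R)"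
    using sum_lessThan_telescope'[of "\<lambda>k. s (q k)" r] unfolding q
    by (simp add: sum_divide_distrib[symmetric])
  also have "\<dots> \<le> s (n - r) / (4 * R)" using s_le R by (intro divide_right_mono) auto
  finally have A: "\<bar>R * (p n - p (n - r)) - (\<Sum>k<r. dickman_at r (q k))\<bar> \<le> s (n - r) / (4 * R)" .
  have "\<bar>dickman_primitive v - p n - d * dickman v\<bar> \<le> d\<^sup>2 * s n"
    using dickman_endpoint_rule[OF d(1), of v] vd R unfolding p_def s_def
    by (metis diff_ge_0_iff_ge divide_nonneg_pos of_nat_0_le_iff)
  then have "R * \<bar>dickman_primitive v - p n - d * dickman v\<bar> \<le> R * (d\<^sup>2 * s n)"
    using R by (intro mult_left_mono) auto
  also have "R * (d\<^sup>2 * s n) = s n / (4 * R)" using d(2) by (simp add: mult.assoc[symmetric])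
  also have "\<dots> \<le> s (n - r) / (4 * R)" using s_le R by (intro divide_right_mono) auto
  also have "R * \<bar>dickman_primitive v - p n - d * dickman v\<bar> =
      \<bar>R * (dickman_primitive v - p n) - (R * d) * dickman v\<bar>"
    using R by (simp add: abs_mult_pos' algebra_simps)
  finally have B: "\<bar>R * (dickman_primitive v - p n) - dickman_at r n / 2\<bar> \<le> s (n - r) / (4 * R)"
    unfolding d(3) by (simp add: dickman_at_def v_def R_def[symmetric])
  have "R * (v * dickman v) = R * (dickman_primitive v - p (n - r))"
    using dickman_window[OF v] v1 by (simp add: p_def)
  moreover have "R * (v * dickman v) = (real n + 1/2) * dickman_at r n"
    using R by (simp add: dickman_at_def v_def R_def)
  ultimately have "real n * dickman_at r n - (\<Sum>k<r. dickman_at r (q k)) =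
      (R * (p n - p (n - r)) - (\<Sum>k<r. dickman_at r (q k))) +
      (R * (dickman_primitive v - p n) - dickman_at r n / 2)"
    by (simp add: algebra_simps)
  also have "\<bar>\<dots>\<bar> \<le> s (n - r) / (4 * R) + s (n - r) / (4 * R)" using A B by linarith
  also have "\<dots> = s (n - r) / (2 * R)" by simp
  finally show ?thesis by (simp add: q_def s_def)
qed

text \<open>
The slope at \<open>v - 1\<close> is at most \<open>W \<rho>(v - 1)\<close>, and \<open>\<rho>(v - 1)\<close> is at most \<open>W v \<rho>(v)\<close>: each of the two steps
costs one factor of the decay rate. The requirement \<open>2 \<le> W\<close> covers the value \<open>2\<close> of
\<open>dickman_slope\<close> to the left of \<open>1\<close>.
\<close>

lemma dickman_at_recurrence_relative:
  assumes n: "r < n"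
  defines "R \<equiv> real r + 1/2"
  assumes W: "2 \<le> W" "dickman_rate ((real n + 1/2) / R) \<le> W"
  shows "\<bar>real n * dickman_at r n - (\<Sum>k<r. dickman_at r (n - r + k))\<bar>
    \<le> (W / R)\<^sup>2 * (real n * dickman_at r n)"
proof -
  define v where "v = (real n + 1/2) / R"
  have R: "R > 0" by (simp add: R_def)
  have "v - 1 = (real n + 1/2 - R) / R" using R by (simp add: v_def diff_divide_distrib)
  also have "real n + 1/2 - R = real (n - r)" using n by (simp add: R_def)
  finally have v1: "v - 1 = real (n - r) / R" .
  have v: "v > 1" using n R by (simp add: v_def R_def)
  have pos: "v * dickman v > 0" using dickman_pos[of v] v by simp
  then have "v * dickman v \<noteq> 0" by linarith
  then have rate: "dickman (v - 1) = dickman_rate v * (v * dickman v)"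
    unfolding dickman_rate_def by (rule nonzero_divide_eq_eq[THEN iffD1, OF _ refl])
  have "dickman_slope (v - 1) \<le> W * dickman (v - 1)"
  proof (cases "v - 1 < 1")
    case True
    then show ?thesis using W v by (simp add: dickman_slope_def dickman_eq_1)
  next
    case False
    then have "dickman_slope (v - 1) = dickman_rate (v - 1) * dickman (v - 1)"
      using dickman_pos[of "v - 1"] by (simp add: dickman_slope_def dickman_rate_def)
    moreover have "dickman_rate (v - 1) \<le> W"
      using dickman_rate_mono[of "v - 1" v] False W by (simp add: v_def)
    ultimately show ?thesis using dickman_pos[of "v - 1"] False by (simp add: mult_right_mono)
  qed
  also have "\<dots> \<le> W * (W * (v * dickman v))"
    unfolding rate using W pos by (intro mult_left_mono mult_right_mono) (auto simp: v_def)
  finally have "dickman_slope (v - 1) / (2 * R) \<le> W * (W * (v * dickman v)) / (2 * R)"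
    using R by (intro divide_right_mono) auto
  also have "\<dots> = (W / R)\<^sup>2 * ((real n + 1/2) / 2 * dickman_at r n)"
    using R by (simp add: v_def dickman_at_def R_def[symmetric] power2_eq_square field_simps)
  also have "\<dots> \<le> (W / R)\<^sup>2 * (real n * dickman_at r n)"
    using n dickman_at_pos[of r n] by (intro mult_left_mono mult_right_mono) auto
  finally show ?thesis using dickman_at_recurrence[OF n] v1 unfolding R_def by simp
qed

section \<open>Comparison of perturbed window recurrences\<close>

text \<open>
A decreasing weight favours the far end of the window: the mean distance is at least half the
window length (Chebyshev's sum inequality).
\<close>

lemma sum_weighted_antimono_ge:
  fixes F :: "nat \<Rightarrow> real"
  assumes "\<And>i j. i \<le> j \<Longrightarrow> j < r \<Longrightarrow> F j \<le> F i" "\<And>k. k < r \<Longrightarrow> F k \<ge> 0"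
  shows "(\<Sum>k<r. real (r - k) * F k) \<ge> real r / 2 * (\<Sum>k<r. F k)"
proof (cases "r = 0")
  case False
  let ?S = "\<Sum>k<r. F k"
  have "real r * (\<Sum>k<r. real k * F k) \<le> (\<Sum>k<r. real k) * ?S"
    using Chebyshev_sum_upper[of r real F] assms by (simp add: atLeast0LessThan)
  also have "(\<Sum>k<r. real k) \<le> real r * (real r / 2)"
  proof (induction r)
    case (Suc r) then show ?case by (simp add: algebra_simps)
  qed simp
  then have "(\<Sum>k<r. real k) * ?S \<le> real r * (real r / 2) * ?S"
    using assms by (intro mult_right_mono sum_nonneg) auto
  finally have "real r * (\<Sum>k<r. real k * F k) \<le> real r * (real r / 2 * ?S)" by simp
  then have "(\<Sum>k<r. real k * F k) \<le> real r / 2 * ?S" using False by simp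
  moreover have "(\<Sum>k<r. real (r - k) * F k) = (\<Sum>k<r. real r * F k - real k * F k)"
    by (intro sum.cong) (auto simp: of_nat_diff algebra_simps)
  moreover have "\<dots> = real r * ?S - (\<Sum>k<r. real k * F k)"
    by (simp add: sum_subtractf sum_distrib_left)
  ultimately show ?thesis by (simp add: algebra_simps)
qed simp

text \<open>
A relative error \<open>\<eta>\<close> in each step of the recurrence accumulates once per window of length \<open>r\<close>, and not
once per step, because each step averages over the window. Precisely, \<open>F m exp (a m)\<close> is a
supersolution and \<open>F m exp (- a m)\<close> a subsolution when \<open>a = 4 \<eta> / r\<close>: a term at distance \<open>j\<close> gains
the factor \<open>exp (- a j)\<close> or \<open>exp (a j)\<close>, and since the mean distance is at least \<open>r / 2\<close>, this changes the
average by a relative amount of at least \<open>a r / 4 = \<eta>\<close>.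
\<close>

lemma window_recurrence_comparison:
  fixes f F :: "nat \<Rightarrow> real"
  assumes r: "r > 0" and \<eta>: "0 \<le> \<eta>" "4 * \<eta> \<le> 1"
    and Fpos: "\<And>m. F m > 0" and Fanti: "\<And>m n. m \<le> n \<Longrightarrow> F n \<le> F m"
    and init: "\<And>m. m \<le> r \<Longrightarrow> f m = F m"
    and frec: "\<And>n. r < n \<Longrightarrow> n \<le> N \<Longrightarrow> real n * f n = (\<Sum>k<r. f (n - r + k))"
    and Frec: "\<And>n. r < n \<Longrightarrow> n \<le> N \<Longrightarrow>
      \<bar>real n * F n - (\<Sum>k<r. F (n - r + k))\<bar> \<le> \<eta> * (real n * F n)"
    and m: "m \<le> N"
  shows "F m * exp (- (4 * \<eta> / r * m)) \<le> f m \<and> f m \<le> F m * exp (4 * \<eta> / r * m)"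
  using m
proof (induction m rule: less_induct)
  case (less n)
  define a where "a = 4 * \<eta> / real r"
  have a: "a \<ge> 0" "a * real r = 4 * \<eta>" using \<eta> r by (simp_all add: a_def)
  show ?case
  proof (cases "n \<le> r")
    case True
    have "exp (- (a * real n)) \<le> 1" "1 \<le> exp (a * real n)" using a by simp_all
    then show ?thesis using init[OF True] Fpos[of n] by (simp add: a_def)
  next
    case False
    then have n: "r < n" by simp
    define q where "q = (\<lambda>k. n - r + k)"
    define S where "S = (\<Sum>k<r. F (q k))"
    define M where "M = (\<Sum>k<r. real (r - k) * F (q k))"
    have M: "M \<ge> real r / 2 * S"
      unfolding M_def S_def by (rule sum_weighted_antimono_ge) (auto simp: q_def Fanti Fpos less_imp_le)
    have IH: "F (q k) * exp (- (a * q k)) \<le> f (q k)" "f (q k) \<le> F (q k) * exp (a * q k)" if "k < r" for k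
      using less.IH[of "q k"] less.prems n that by (auto simp: q_def a_def)
    have q: "real (q k) = real n - real (r - k)" if "k < r" for k
      using that n by (simp add: q_def of_nat_diff)
    have nF: "real n * F n > 0" using Fpos n by simp
    have S: "S \<le> (1 + \<eta>) * (real n * F n)" "S \<ge> (1 - \<eta>) * (real n * F n)"
      using Frec[OF n less.prems] by (auto simp: S_def q_def algebra_simps abs_le_iff)
    have ea: "a * real (r - k) \<in> {0..1}" for k
    proof -
      have "a * real (r - k) \<le> a * real r" using a by (intro mult_left_mono) auto
      then show ?thesis using a \<eta> by simp
    qed
    have "real n * f n = (\<Sum>k<r. f (q k))" using frec[OF n less.prems] by (simp add: q_def)
    also have "\<dots> \<le> (\<Sum>k<r. F (q k) * exp (a * q k))" using IH by (intro sum_mono) auto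
    also have "\<dots> = (\<Sum>k<r. exp (a * n) * (F (q k) * exp (- (a * real (r - k)))))"
      by (intro sum.cong) (auto simp: q right_diff_distrib exp_diff exp_minus field_simps simp flip: exp_add)
    \<comment> \<open>\<open>exp (- x) \<le> 1 - x / 2\<close> on \<open>[0, 1]\<close>; the condition \<open>4 * \<eta> \<le> 1\<close> keeps \<open>x\<close> in that range\<close>
    also have "\<dots> \<le> (\<Sum>k<r. exp (a * n) * (F (q k) * (1 - a * real (r - k) / 2)))"
    proof (intro sum_mono mult_left_mono)
      fix k
      let ?x = "a * real (r - k)"
      have "exp (- ?x) * (1 + ?x) \<le> exp (- ?x) * exp ?x" using exp_ge_add_one_self[of ?x] by simp
      also have "\<dots> = 1" by (simp flip: exp_add)
      also have "1 \<le> (1 - ?x / 2) * (1 + ?x)"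
      proof -
        have "?x * ?x \<le> 1 * ?x" using ea[of k] by (intro mult_right_mono) auto
        then show ?thesis by (simp add: algebra_simps)
      qed
      finally show "exp (- ?x) \<le> 1 - ?x / 2" using ea[of k] by (simp add: mult_le_cancel_right)
    qed (use Fpos in \<open>auto simp: less_imp_le\<close>)
    also have "\<dots> = exp (a * n) * (S - a / 2 * M)"
      unfolding S_def M_def sum_distrib_left sum_subtractf[symmetric]
      by (intro sum.cong) (simp_all add: field_simps)
    also have "\<dots> \<le> exp (a * n) * ((1 - \<eta>) * S)"
    proof (intro mult_left_mono)
      have "a / 2 * (real r / 2 * S) \<le> a / 2 * M" using M a by (intro mult_left_mono) auto
      also have "a / 2 * (real r / 2 * S) = (a * real r) * S / 4" by simp
      finally have "\<eta> * S \<le> a / 2 * M" unfolding a(2) by simp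
      then show "S - a / 2 * M \<le> (1 - \<eta>) * S" by (simp add: left_diff_distrib)
    qed simp
    also have "\<dots> \<le> exp (a * n) * ((1 - \<eta>) * ((1 + \<eta>) * (real n * F n)))"
      using S \<eta> by (intro mult_left_mono) auto
    also have "\<dots> \<le> exp (a * n) * (1 * (real n * F n))"
    proof -
      have "(1 - \<eta>) * (1 + \<eta>) \<le> 1" by (simp add: algebra_simps)
      then show ?thesis unfolding mult.assoc[of "1 - \<eta>", symmetric]
        using nF by (intro mult_left_mono mult_right_mono) auto
    qed
    finally have upper: "f n \<le> F n * exp (a * n)" using n by (simp add: mult.assoc mult.commute)
    have "exp (- (a * n)) * (real n * F n) \<le> exp (- (a * n)) * ((1 + 2 * \<eta>) * ((1 - \<eta>) * (real n * F n)))"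
    proof -
      have "1 \<le> (1 + 2 * \<eta>) * (1 - \<eta>)"
      proof -
        have "\<eta> * (2 * \<eta>) \<le> \<eta> * 1" using \<eta> by (intro mult_left_mono) auto
        then show ?thesis by (simp add: algebra_simps)
      qed
      then have "1 * (real n * F n) \<le> (1 + 2 * \<eta>) * (1 - \<eta>) * (real n * F n)"
        using nF by (intro mult_right_mono) auto
      then show ?thesis by (intro mult_left_mono) auto
    qed
    also have "\<dots> \<le> exp (- (a * n)) * ((1 + 2 * \<eta>) * S)"
      using S \<eta> by (intro mult_left_mono) auto
    also have "\<dots> \<le> exp (- (a * n)) * (S + a * M)"
    proof (intro mult_left_mono)
      have "a * (real r / 2 * S) \<le> a * M" using M a by (intro mult_left_mono) auto
      also have "a * (real r / 2 * S) = (a * real r) * S / 2" by simp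
      finally have "2 * \<eta> * S \<le> a * M" unfolding a(2) by (simp add: mult_ac)
      then show "(1 + 2 * \<eta>) * S \<le> S + a * M" by (simp add: distrib_right)
    qed simp
    also have "\<dots> = (\<Sum>k<r. exp (- (a * n)) * (F (q k) * (1 + a * real (r - k))))"
      unfolding S_def M_def sum_distrib_left sum.distrib[symmetric]
      by (intro sum.cong) (simp_all add: algebra_simps)
    also have "\<dots> \<le> (\<Sum>k<r. exp (- (a * n)) * (F (q k) * exp (a * real (r - k))))"
      using Fpos exp_ge_add_one_self by (intro sum_mono mult_left_mono) (auto simp: less_imp_le)
    also have "\<dots> = (\<Sum>k<r. F (q k) * exp (- (a * q k)))"
      by (intro sum.cong) (auto simp: q right_diff_distrib exp_diff exp_minus field_simps simp flip: exp_add)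
    also have "\<dots> \<le> (\<Sum>k<r. f (q k))" using IH by (intro sum_mono) auto
    also have "\<dots> = real n * f n" using frec[OF n less.prems] by (simp add: q_def)
    finally have lower: "F n * exp (- (a * n)) \<le> f n" using n by (simp add: mult.left_commute mult.commute)
    show ?thesis using upper lower by (simp add: a_def)
  qed
qed

section \<open>The asymptotic formula\<close>

text \<open>
What the range of \<open>r\<close> is needed for. The lower bound on \<open>r\<close>, cubed, says \<open>n log\<^sup>2 n \<le> r\<^sup>3\<close>, which
bounds the first error term. The upper bound gives \<open>u \<ge> 12 \<pi>\<^sup>2 e log n (log log n)\<^sup>2\<close>, and this
exceeds \<open>16\<close> already for \<open>n = 4\<close>; then \<open>16 log\<^sup>2 (u + 1) \<le> r\<^sup>2\<close>, so the comparison of recurrences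
applies to every admissible \<open>n\<close> and \<open>r\<close>.
\<close>

lemma short_range_bounds:
  fixes n r :: nat and u :: real
  assumes n: "n \<ge> 4" and u: "u = real n / real r"
    and lower: "real n powr (1/3) * ln (real n) powr (2/3) \<le> real r"
    and upper: "real r \<le> 1 / (12 * pi\<^sup>2 * exp 1) * real n * inverse (ln (real n)) * inverse ((ln (ln (real n)))\<^sup>2)"
  shows "r \<ge> 2" "r < n" "u \<ge> 16" "u * (ln (u + 1))\<^sup>2 / (real r)\<^sup>2 \<le> 1"
proof -
  define l where "l = ln (real n)"
  have "ln 4 = 2 * ln (2::real)" using ln_realpow[of 2 2] by simp
  then have "ln (4::real) \<ge> 4/3" using ln2_ge_two_thirds by simp
  moreover have "ln 4 \<le> l" using n by (simp add: l_def)
  ultimately have l: "l \<ge> 4/3" by simp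
  have ll: "ln l \<ge> 1/4"
  proof -
    have "inverse l \<le> inverse (4/3)" using l by (intro le_imp_inverse_le) auto
    moreover have "- ln l \<le> inverse l - 1"
      using ln_le_minus_one[of "inverse l"] l by (simp add: ln_inverse)
    ultimately show ?thesis by simp
  qed
  show r2: "r \<ge> 2"
  proof -
    have "real n powr (1/3) > 1" "l powr (2/3) > 1" using n l by (auto intro!: gr_one_powr)
    then have "1 < real n powr (1/3) * l powr (2/3)" by (smt (verit) mult_less_cancel_right1 mult_less_cancel_left2)
    then show ?thesis using lower by (simp add: l_def)
  qed
  have c: "12 * pi\<^sup>2 * exp 1 \<ge> 270"
  proof -
    have "pi\<^sup>2 \<ge> 3\<^sup>2" using pi_gt3 by (intro power_mono) auto
    moreover have "exp 1 \<ge> (5/2 :: real)" using exp_lower_Taylor_quadratic[of 1] by simp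
    ultimately have "pi\<^sup>2 * exp 1 \<ge> 9 * (5/2)" by (intro mult_mono) auto
    then show ?thesis by (simp add: mult_ac)
  qed
  show u16: "u \<ge> 16"
  proof -
    let ?c = "12 * pi\<^sup>2 * exp (1::real)"
    have "?c * (l * (ln l)\<^sup>2) > 0" using c l ll by (intro mult_pos_pos) auto
    moreover have "real r \<le> real n / (?c * (l * (ln l)\<^sup>2))"
      using upper unfolding l_def[symmetric] by (simp only: divide_inverse inverse_mult_distrib mult_1_left mult_ac)
    ultimately have "real r * (?c * (l * (ln l)\<^sup>2)) \<le> real n" by (simp only: pos_le_divide_eq)
    moreover have "?c * (l * (ln l)\<^sup>2) \<ge> 270 * (4/3 * (1/4)\<^sup>2)"
      using c l ll by (intro mult_mono power_mono) auto
    then have "real r * (?c * (l * (ln l)\<^sup>2)) \<ge> real r * 16"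
      by (intro mult_left_mono) (auto simp: power2_eq_square)
    ultimately have "real r * 16 \<le> real n" by linarith
    then show ?thesis using r2 by (simp add: u field_simps)
  qed
  show "r < n"
  proof -
    have "real r * 16 \<le> real n" using u16 r2 by (simp add: u field_simps)
    then show ?thesis using r2 by linarith
  qed
  have "(real n powr (1/3) * l powr (2/3)) ^ 3 \<le> real r ^ 3"
    using lower unfolding l_def by (intro power_mono) auto
  also have "(real n powr (1/3) * l powr (2/3)) ^ 3 = real n * l\<^sup>2"
    using n l by (simp add: power_mult_distrib powr_power)
  finally have nl: "real n * l\<^sup>2 \<le> real r ^ 3" .
  have "ln (u + 1) \<le> l"
  proof -
    have "u \<le> real n / 2" unfolding u using r2 by (intro divide_left_mono) auto
    then have "u + 1 \<le> real n" using n by (simp add: field_simps)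
    then show ?thesis unfolding l_def using u16 by simp
  qed
  then have "real n * (ln (u + 1))\<^sup>2 \<le> real n * l\<^sup>2"
    using u16 by (intro mult_left_mono power_mono) auto
  also note nl
  finally show "u * (ln (u + 1))\<^sup>2 / (real r)\<^sup>2 \<le> 1"
    using r2 by (simp add: u field_simps power2_eq_square power3_eq_cube)
qed

text \<open>
The decay rate stays below \<open>\<xi>(u + 1) \<le> 2 L\<close> over the whole range, so each step of the recurrence has
relative error at most \<open>(2 L / r)\<^sup>2\<close>, and there are \<open>u = n / r\<close> windows.
\<close>

lemma nu_between_dickman_at:
  fixes n r :: nat
  defines "L \<equiv> ln (real n / real r + 1)"
  defines "A \<equiv> 16 * (real n / real r * L\<^sup>2 / (real r)\<^sup>2)"
  assumes r: "r > 0" "r < n" and L: "L \<ge> 1" and small: "16 * L\<^sup>2 \<le> (real r)\<^sup>2"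
  shows "nu n r \<in> {dickman_at r n * exp (- A)..dickman_at r n * exp A}"
proof -
  define u where "u = real n / real r"
  define R where "R = real r + 1/2"
  define \<eta> where "\<eta> = (2 * L / R)\<^sup>2"
  have u1: "u > 1" using r by (simp add: u_def)
  have R: "R > 0" "(real r)\<^sup>2 \<le> R\<^sup>2" unfolding R_def by (auto intro: power_mono)
  have rate: "dickman_rate ((real m + 1/2) / R) \<le> 2 * L" if m: "r < m" "m \<le> n" for m
  proof -
    have "(real m + 1/2) / R \<le> (real n + 1/2) / R" using m R by (intro divide_right_mono) auto
    also have "\<dots> \<le> u" using r R by (simp add: u_def R_def field_simps)
    finally have "dickman_rate ((real m + 1/2) / R) \<le> dickman_rate u"
      using m R by (intro dickman_rate_mono) (auto simp: R_def)
    also have "\<dots> \<le> xi (u + 1)" using u1 by (intro dickman_rate_le_xi) simp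
    also have "\<dots> \<le> 2 * ln (u + 1)" using u1 by (intro xi_le_ln) simp
    finally show ?thesis by (simp add: L_def u_def)
  qed
  have "4 * \<eta> = 16 * L\<^sup>2 / R\<^sup>2" by (simp add: \<eta>_def power_divide power_mult_distrib)
  also have "\<dots> \<le> 1" using order_trans[OF small R(2)] R(1) by simp
  finally have \<eta>: "4 * \<eta> \<le> 1" .
  have "dickman_at r n * exp (- (4 * \<eta> / real r * real n)) \<le> nu n r \<and>
        nu n r \<le> dickman_at r n * exp (4 * \<eta> / real r * real n)"
  proof (rule window_recurrence_comparison[where N = n])
    show "\<bar>real m * dickman_at r m - (\<Sum>k<r. dickman_at r (m - r + k))\<bar> \<le> \<eta> * (real m * dickman_at r m)"
      if "r < m" "m \<le> n" for m
      unfolding \<eta>_def R_def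
      by (rule dickman_at_recurrence_relative) (use that rate[of m] L in \<open>auto simp: R_def\<close>)
  qed (use r \<eta> in \<open>auto simp: \<eta>_def dickman_at_pos dickman_at_antimono dickman_at_eq_1 nu_eq_1 nu_recurrence\<close>)
  moreover have "4 * \<eta> / real r * real n \<le> A"
  proof -
    have "4 * \<eta> / real r * real n = 16 * (u * L\<^sup>2 / R\<^sup>2)"
      by (simp add: \<eta>_def u_def power_divide power_mult_distrib mult_ac)
    also have "\<dots> \<le> 16 * (u * L\<^sup>2 / (real r)\<^sup>2)"
      using R r u1 by (intro mult_left_mono divide_left_mono) auto
    finally show ?thesis by (simp add: A_def u_def)
  qed
  then have "dickman_at r n * exp (- A) \<le> dickman_at r n * exp (- (4 * \<eta> / real r * real n))"
    "dickman_at r n * exp (4 * \<eta> / real r * real n) \<le> dickman_at r n * exp A"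
    using dickman_at_pos[of r n] by (intro mult_left_mono; simp)+
  ultimately show ?thesis by auto
qed

text \<open>
The argument of \<open>\<rho>\<close> in \<open>dickman_at r n\<close> is \<open>u - h\<close> with \<open>h = (u - 1) / (2 r + 1)\<close>, which is close to
\<open>u / (2 r)\<close>. Moving back by \<open>h\<close> multiplies \<open>\<rho>(u)\<close> by about \<open>exp (h \<xi>(u))\<close>. The replacement of \<open>h\<close> by
\<open>u / (2 r)\<close> and the variation of \<open>\<xi>\<close> cost \<open>O(L / r + u L / r\<^sup>2)\<close>, where \<open>L = log (u + 1)\<close>.
The term \<open>L / r\<close> is the geometric mean of \<open>u L\<^sup>2 / r\<^sup>2\<close> and \<open>1 / u\<close>.
\<close>

lemma dickman_at_ratio:
  fixes n r :: nat and u :: real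
  assumes u: "u = real n / real r" and r: "r \<ge> 2" and u16: "u \<ge> 16"
  defines "X \<equiv> u * (ln (u + 1))\<^sup>2 / (real r)\<^sup>2"
  shows "\<bar>ln (dickman_at r n / dickman u) - u * xi u / (2 * real r)\<bar> \<le> 2 * (X + 1 / u)"
proof -
  define L where "L = ln (u + 1)"
  define h where "h = (u - 1) / (2 * real r + 1)"
  define v where "v = u - h"
  define D where "D = ln (dickman_at r n / dickman u)"
  have L: "L \<ge> 1" unfolding L_def using u16 exp_le by (subst ln_ge_iff) auto
  have n: "real n = u * real r" using r by (simp add: u)
  have "(real n + 1/2) / (real r + 1/2) = v"
    unfolding n v_def h_def by (simp add: field_simps)
  then have Fv: "dickman_at r n = dickman v" by (simp add: dickman_at_def)
  have h: "0 \<le> h" "h \<le> u / (2 * real r)" unfolding h_def using u16 r by (auto intro!: frac_le)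
  have "u / (2 * real r) \<le> u / 4" using r u16 by (intro divide_left_mono) auto
  then have v: "v \<ge> u / 2" "v > 1" "v \<le> u" using h u16 by (auto simp: v_def)
  have pos: "dickman u > 0" "dickman v > 0" using dickman_pos u16 v by auto
  have D1: "D \<le> h * xi (u + 1)"
  proof -
    have "dickman v \<le> dickman u * exp (dickman_rate u * h)"
      using dickman_le_exp[of u v] v u16 by (simp add: v_def)
    then have "dickman v / dickman u \<le> exp (dickman_rate u * h)" using pos by (simp add: field_simps)
    then have "D \<le> ln (exp (dickman_rate u * h))" unfolding D_def Fv using pos by (subst ln_le_cancel_iff) auto
    also have "\<dots> \<le> xi (u + 1) * h"
      using dickman_rate_le_xi[of u] u16 h by (simp add: mult_right_mono)
    finally show ?thesis by (simp add: mult.commute)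
  qed
  have D2: "D \<ge> h * xi v"
  proof -
    have "dickman u * exp (dickman_rate v * h) \<le> dickman v"
      using exp_le_dickman[of v v u] v by (simp add: v_def)
    then have "exp (dickman_rate v * h) \<le> dickman v / dickman u" using pos by (simp add: field_simps)
    then have "ln (exp (dickman_rate v * h)) \<le> D" unfolding D_def Fv using pos by (subst ln_le_cancel_iff) auto
    moreover have "xi v * h \<le> dickman_rate v * h"
      using xi_le_dickman_rate[of v] v h by (intro mult_right_mono) auto
    ultimately show ?thesis by (simp add: mult.commute)
  qed
  have XL: "X = u * L\<^sup>2 / (real r)\<^sup>2" by (simp add: X_def L_def)
  have amgm: "L / real r \<le> (X + 1 / u) / 2"
  proof -
    have "0 \<le> (u * L / real r - 1)\<^sup>2 / u" using u16 by simp
    also have "\<dots> = X + 1 / u - 2 * (L / real r)"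
      using u16 r by (simp add: XL field_simps power2_eq_square)
    finally have "2 * (L / real r) \<le> X + 1 / u" by (simp only: diff_ge_0_iff_ge)
    then show ?thesis by (simp only: le_divide_eq_numeral1 mult.commute)
  qed
  have X: "u / (real r)\<^sup>2 \<le> X" "u * L / (real r)\<^sup>2 \<le> X"
  proof -
    have "L * 1 \<le> L * L" using L by (intro mult_left_mono) auto
    then have L2: "L \<le> L\<^sup>2" "1 \<le> L\<^sup>2" using one_le_power[OF L, of 2] by (simp_all add: power2_eq_square)
    then have "u * 1 \<le> u * L\<^sup>2" "u * L \<le> u * L\<^sup>2" using u16 by (intro mult_left_mono; simp)+
    then show "u / (real r)\<^sup>2 \<le> X" "u * L / (real r)\<^sup>2 \<le> X"
      unfolding XL by (auto intro: divide_right_mono)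
  qed
  have xi_u: "0 < xi u" "xi u \<le> 2 * L"
  proof -
    have "ln u \<le> L" using u16 by (simp add: L_def)
    then show "0 < xi u" "xi u \<le> 2 * L" using xi_props[of u] xi_le_ln[of u] u16 by auto
  qed
  have "D - u * xi u / (2 * real r) \<le> 1 / real r"
  proof -
    have "0 < xi (u + 1)" using xi_props u16 by simp
    then have "h * xi (u + 1) \<le> u / (2 * real r) * xi (u + 1)" using h by (intro mult_right_mono) auto
    also have "\<dots> = u * xi u / (2 * real r) + u / (2 * real r) * (xi (u + 1) - xi u)"
      by (simp add: right_diff_distrib)
    also have "u / (2 * real r) * (xi (u + 1) - xi u) \<le> u / (2 * real r) * (2 / u)"
      using xi_lipschitz[of u "u + 1"] u16 by (intro mult_left_mono) auto
    also have "u / (2 * real r) * (2 / u) = 1 / real r" using u16 by simp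
    finally show ?thesis using D1 by simp
  qed
  also have "1 / real r \<le> L / real r" using L by (intro divide_right_mono) auto
  also note amgm
  finally have U: "D - u * xi u / (2 * real r) \<le> (X + 1 / u) / 2" .
  have "(u / (2 * real r) - h) * xi u \<le> (u / (4 * (real r)\<^sup>2) + 1 / (2 * real r)) * (2 * L)"
  proof (intro mult_mono)
    have "u / (2 * real r) - h = (u + 2 * real r) / (2 * real r * (2 * real r + 1))"
      using r by (simp add: h_def field_simps)
    also have "\<dots> \<le> (u + 2 * real r) / (2 * real r * (2 * real r))"
      using r u16 by (intro divide_left_mono mult_left_mono) auto
    also have "\<dots> = u / (4 * (real r)\<^sup>2) + 1 / (2 * real r)"
      using r by (simp add: field_simps power2_eq_square)
    finally show "u / (2 * real r) - h \<le> u / (4 * (real r)\<^sup>2) + 1 / (2 * real r)" .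
  qed (use xi_u u16 in auto)
  also have "\<dots> = u * L / (real r)\<^sup>2 / 2 + L / real r"
    by (simp add: algebra_simps)
  finally have A: "(u / (2 * real r) - h) * xi u \<le> u * L / (real r)\<^sup>2 / 2 + L / real r" .
  have "h * (xi u - xi v) \<le> u / (2 * real r) * (2 * (u / (2 * real r)) / (u / 2))"
  proof (intro mult_mono)
    have "xi u - xi v \<le> 2 * h / v" using xi_lipschitz[of v u] v by (simp add: v_def)
    also have "\<dots> \<le> 2 * (u / (2 * real r)) / (u / 2)"
      using h v u16 by (intro frac_le mult_left_mono) auto
    finally show "xi u - xi v \<le> 2 * (u / (2 * real r)) / (u / 2)" .
  qed (use h v xi_mono[of v u] u16 in auto)
  also have "u / (2 * real r) * (2 * (u / (2 * real r)) / (u / 2)) = u / (real r)\<^sup>2"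
    using u16 r by (simp add: field_simps power2_eq_square)
  finally have B: "h * (xi u - xi v) \<le> u / (real r)\<^sup>2" .
  have "u * xi u / (2 * real r) - D \<le> (u / (2 * real r) - h) * xi u + h * (xi u - xi v)"
    using D2 by (simp add: algebra_simps)
  also have "\<dots> \<le> u * L / (real r)\<^sup>2 / 2 + L / real r + u / (real r)\<^sup>2"
    by (intro add_mono A B)
  also have "\<dots> \<le> X / 2 + (X + 1 / u) / 2 + X"
    by (intro add_mono divide_right_mono X amgm) simp
  also have "\<dots> \<le> 2 * (X + 1 / u)"
  proof -
    have inverse_u: "0 \<le> 1 / u" using u16 by simp
    have "X / 2 + (X + y) / 2 + X \<le> 2 * (X + y)" if "y \<ge> 0" for y :: real
      using that by (simp add: field_simps)
    from this[of "1 / u"] show ?thesis using inverse_u by blast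
  qed
  finally have V: "u * xi u / (2 * real r) - D \<le> 2 * (X + 1 / u)" .
  have half: "y / 2 \<le> 2 * y" if "y \<ge> 0" for y :: real using that by simp
  have "X \<ge> 0" "1 / u \<ge> 0" unfolding X_def using u16 by simp_all
  then have "(X + 1 / u) / 2 \<le> 2 * (X + 1 / u)" by (intro half add_nonneg_nonneg)
  then show ?thesis
    using U V unfolding D_def[symmetric] abs_le_iff minus_diff_eq by (blast intro: order_trans)
qed

lemma abs_exp_minus_1_le: "\<bar>exp x - 1\<bar> \<le> \<bar>x\<bar> * exp \<bar>x :: real\<bar>"
proof (cases "x \<ge> 0")
  case True
  have "(1 - x) * exp x \<le> exp (- x) * exp x"
    using exp_ge_add_one_self[of "- x"] by (intro mult_right_mono) auto
  then show ?thesis using True by (simp add: left_diff_distrib flip: exp_add)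
next
  case False
  then have "exp x \<le> 1" by simp
  moreover have "1 + x \<le> exp x" by (rule exp_ge_add_one_self)
  ultimately have "\<bar>exp x - 1\<bar> \<le> \<bar>x\<bar> * 1" using False by linarith
  also have "\<dots> \<le> \<bar>x\<bar> * exp \<bar>x\<bar>" by (intro mult_left_mono) auto
  finally show ?thesis .
qed

theorem theorem2p4:
  fixes c :: real
  assumes "c = 1 / (12 * pi\<^sup>2 * exp 1)"
  shows "\<exists>K>0. \<forall>(n::nat) (r::nat) u::real.
    n \<ge> 4 \<longrightarrow> u = real n / real r \<longrightarrow>
    real n powr (1/3) * ln (real n) powr (2/3) \<le> real r \<longrightarrow>
    real r \<le> c * real n * inverse (ln (real n)) * inverse ((ln (ln (real n)))\<^sup>2) \<longrightarrow>
    (\<exists>\<epsilon>::real.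
       \<bar>\<epsilon>\<bar> \<le> K * (u * (ln (u + 1))\<^sup>2 / (real r)\<^sup>2 + 1 / u) \<and>
       nu n r = dickman u * exp (u * xi u / (2 * real r)) * (1 + \<epsilon>))"
proof (rule exI[of _ "18 * exp 36"], intro conjI allI impI)
  fix n r :: nat and u :: real
  assume n: "n \<ge> 4" and u: "u = real n / real r"
    and lower: "real n powr (1/3) * ln (real n) powr (2/3) \<le> real r"
    and upper: "real r \<le> c * real n * inverse (ln (real n)) * inverse ((ln (ln (real n)))\<^sup>2)"
  define L where "L = ln (u + 1)"
  define X where "X = u * L\<^sup>2 / (real r)\<^sup>2"
  note range = short_range_bounds[OF n u lower upper[unfolded assms]]
  have r: "r \<ge> 2" "r < n" and u16: "u \<ge> 16" and X1: "X \<le> 1"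
    using range by (simp_all add: X_def L_def)
  have X0: "X \<ge> 0" using u16 by (simp add: X_def)
  have L: "L \<ge> 1" unfolding L_def using u16 exp_le by (subst ln_ge_iff) auto
  have small: "16 * L\<^sup>2 \<le> (real r)\<^sup>2"
  proof -
    have "16 * L\<^sup>2 \<le> u * L\<^sup>2" using u16 by (intro mult_right_mono) auto
    also have "\<dots> \<le> (real r)\<^sup>2" using X1 r by (simp add: X_def field_simps)
    finally show ?thesis .
  qed
  define M where "M = dickman u * exp (u * xi u / (2 * real r))"
  define F where "F = dickman_at r n"
  \<comment> \<open>The deviation on the logarithmic scale is \<open>16 X\<close> from the recurrence and \<open>2 (X + 1 / u)\<close> from the shift.
    It is bounded by \<open>36\<close>, so exponentiating costs only a constant factor.\<close>
  define \<delta> where "\<delta> = ln (nu n r / M)"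
  have M: "M > 0" using dickman_pos u16 by (simp add: M_def)
  have F: "F > 0" by (simp add: F_def dickman_at_pos)
  have nu: "F * exp (- (16 * X)) \<le> nu n r" "nu n r \<le> F * exp (16 * X)"
    using nu_between_dickman_at[of r n] r L small by (auto simp: F_def X_def L_def u)
  have nu_pos: "nu n r > 0" using nu(1) F by (smt (verit) exp_gt_zero mult_pos_pos)
  have "ln (F * exp (- (16 * X))) \<le> ln (nu n r)" "ln (nu n r) \<le> ln (F * exp (16 * X))"
    using nu nu_pos F by simp_all
  then have "\<bar>ln (nu n r) - ln F\<bar> \<le> 16 * X" using F by (simp add: ln_mult)
  moreover have "\<bar>ln F - ln (dickman u) - u * xi u / (2 * real r)\<bar> \<le> 2 * (X + 1 / u)"
    using dickman_at_ratio[OF u r(1) u16] F dickman_pos[of u] u16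
    by (simp add: F_def X_def L_def ln_div)
  moreover have "\<delta> = ln (nu n r) - ln (dickman u) - u * xi u / (2 * real r)"
    using nu_pos M dickman_pos[of u] u16 by (simp add: \<delta>_def ln_div M_def ln_mult)
  moreover have "16 * X \<le> 16 * (X + 1 / u)" using u16 by simp
  ultimately have \<delta>: "\<bar>\<delta>\<bar> \<le> 18 * (X + 1 / u)" by linarith
  have "1 / u \<le> 1" using u16 by simp
  then have "18 * (X + 1 / u) \<le> 18 * (1 + 1)" using X1 by (intro mult_left_mono add_mono) auto
  then have \<delta>36: "\<bar>\<delta>\<bar> \<le> 36" using \<delta> by simp
  have "\<bar>exp \<delta> - 1\<bar> \<le> \<bar>\<delta>\<bar> * exp \<bar>\<delta>\<bar>" by (rule abs_exp_minus_1_le)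
  also have "\<dots> \<le> (18 * (X + 1 / u)) * exp 36"
    using \<delta> \<delta>36 X0 u16 by (intro mult_mono) auto
  also have "(18 * (X + 1 / u)) * exp 36 = 18 * exp 36 * (X + 1 / u)" by (simp only: mult_ac)
  finally have "\<bar>exp \<delta> - 1\<bar> \<le> 18 * exp 36 * (X + 1 / u)" .
  moreover have "nu n r = M * (1 + (exp \<delta> - 1))"
    using nu_pos M by (simp add: \<delta>_def)
  ultimately show "\<exists>\<epsilon>::real. \<bar>\<epsilon>\<bar> \<le> 18 * exp 36 * (u * (ln (u + 1))\<^sup>2 / (real r)\<^sup>2 + 1 / u) \<and>
       nu n r = dickman u * exp (u * xi u / (2 * real r)) * (1 + \<epsilon>)"
    unfolding X_def L_def M_def by blast
qed simp

end
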